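(* For positive integers $m,n\equiv1\pmod{24}$ we have $$n^{\frac32}\cdot p_n^+(m)=m^{\frac32}\cdot p_m^+(n).$$
   Context: Write $z=x+iy\in\mathbb{H}$, $q=e^{2\pi i z}$, $q^{r}=e^{2\pi i r z}$ for $r\in\mathbb{Q}$; powers use the principal branch. The eta function $\eta(z)=q^{1/24}\prod_{n\ge1}(1-q^n)$ satisfies $\eta(\gamma z)=\varepsilon(\gamma)(cz+d)^{1/2}\eta(z)$ for $\gamma=\begin{pmatrix}a&b\\c&d\end{pmatrix}\in \mathrm{SL}_2(\mathbb{Z})$, which defines the multiplier system $\varepsilon$. For $k=5/2$, $H_k^!(\varepsilon)$ is the complex vector space of real analytic $f:\mathbb{H}\to\mathbb{C}$ such that $f(\gamma z)=\varepsilon(\gamma)(cz+d)^kf(z)$ for all $\gamma\in\mathrm{SL}_2(\mathbb{Z})$, $\Delta_kf=0$ where $\Delta_k=-y^2\left(\frac{\partial^2}{\partial x^2}+\frac{\partial^2}{\partial y^2}\right)+iky\left(\frac{\partial}{\partial x}+i\frac{\partial}{\partial y}\right)$, and such that in the Fourier expansion $$f(z)=\sum_{n\equiv1\,(24)}a^+(n)q^{n/24}+\sum_{n\equiv-1\,(24)}a^-(n)\,\Gamma\!\left(1-k,\tfrac{\pi ny}{6}\right)q^{-n/24}$$ only finitely many $a^{\pm}(n)$ with $n\le0$ are nonzero. $\beta(y)=\Gamma\!\left(-\tfrac32,\tfrac{\pi y}{6}\right)$, where $\Gamma(s,y)=\int_y^\infty e^{-t}t^{s-1}dt$; for negative real $y$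 the principal branch is used ($\arg y=\pi$, path of integration through the upper half plane). For positive $m\equiv1\pmod{24}$ the numbers $p_m^+(n)$ are defined as follows: there is a unique $h_m\in H^!_{5/2}(\varepsilon)$ with Fourier expansion of the form $$h_m(z)=\sum_{0<n\equiv1\,(24)}p_m^+(n)q^{n/24}+i\beta(-my)q^{m/24}+\sum_{0<n\equiv-1\,(24)}p_m^-(n)\beta(ny)q^{-n/24}.$$ *)

theory Defs
  imports "HOL-Complex_Analysis.Complex_Analysis" "HOL-Number_Theory.Cong"
begin

definition upper_half_plane :: "complex set" where
  "upper_half_plane = {z. 0 < Im z}"

definition q_pow :: "real \<Rightarrow> complex \<Rightarrow> complex" where
  "q_pow r z = exp (2 * of_real pi * \<i> * of_real r * z)"

definition dedekind_eta :: "complex \<Rightarrow> complex" where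
  "dedekind_eta z = q_pow (1 / 24) z * prodinf (\<lambda>n. 1 - q_pow (real (Suc n)) z)"

text \<open>A matrix in SL(2, Z) is given by its entries \<open>a b c d\<close> with \<open>a * d - b * c = 1\<close>.\<close>

definition moebius_int :: "int \<Rightarrow> int \<Rightarrow> int \<Rightarrow> int \<Rightarrow> complex \<Rightarrow> complex" where
  "moebius_int a b c d z = (of_int a * z + of_int b) / (of_int c * z + of_int d)"

definition eta_multiplier :: "int \<Rightarrow> int \<Rightarrow> int \<Rightarrow> int \<Rightarrow> complex" where
  "eta_multiplier a b c d =
     (THE e. \<forall>z\<in>upper_half_plane.
        dedekind_eta (moebius_int a b c d z) =
          e * (of_int c * z + of_int d) powr (1 / 2) * dedekind_eta z)"

text \<open>Real analyticity on an open set: local expansion in an (absolutely convergent) power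
  series in the two real variables \<open>Re z\<close> and \<open>Im z\<close>.\<close>

definition real_analytic_on :: "(complex \<Rightarrow> complex) \<Rightarrow> complex set \<Rightarrow> bool" where
  "real_analytic_on f S \<longleftrightarrow>
     (\<forall>w\<in>S. \<exists>r>0. \<exists>c :: nat \<Rightarrow> nat \<Rightarrow> complex. ball w r \<subseteq> S \<and>
        (\<forall>z\<in>ball w r.
           ((\<lambda>(i, j). c i j * of_real ((Re z - Re w) ^ i * (Im z - Im w) ^ j))
              has_sum f z) UNIV))"

definition partial_x :: "(complex \<Rightarrow> complex) \<Rightarrow> complex \<Rightarrow> complex" where
  "partial_x f z = vector_derivative (\<lambda>t. f (z + of_real t)) (at 0)"

definition partial_y :: "(complex \<Rightarrow> complex) \<Rightarrow> complex \<Rightarrow> complex" where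
  "partial_y f z = vector_derivative (\<lambda>t. f (z + \<i> * of_real t)) (at 0)"

definition hyperbolic_laplacian :: "real \<Rightarrow> (complex \<Rightarrow> complex) \<Rightarrow> complex \<Rightarrow> complex" where
  "hyperbolic_laplacian k f z =
     - (of_real (Im z))\<^sup>2 * (partial_x (partial_x f) z + partial_y (partial_y f) z)
     + \<i> * of_real k * of_real (Im z) * (partial_x f z + \<i> * partial_y f z)"

text \<open>The incomplete Gamma function at real \<open>y \<noteq> 0\<close>. For \<open>y < 0\<close> the path of integration runs
  from \<open>y\<close> to \<open>-y\<close> along the semicircle in the upper half plane and then along the positive
  real axis; the principal branch of \<open>t powr (s - 1)\<close> is continuous along this path, where
  \<open>Arg t\<close> decreases from \<open>pi\<close> to \<open>0\<close>. The value at \<open>y = 0\<close> is never used.\<close>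

definition inc_Gamma :: "real \<Rightarrow> real \<Rightarrow> complex" where
  "inc_Gamma s y =
     (let g = (\<lambda>t :: complex. exp (- t) * t powr (of_real s - 1)) in
      if y \<ge> 0 then integral {y..} (\<lambda>t. g (of_real t))
      else contour_integral (part_circlepath 0 (- y) pi 0) g
           + integral {- y..} (\<lambda>t. g (of_real t)))"

definition beta_fun :: "real \<Rightarrow> complex" where
  "beta_fun y = inc_Gamma (- 3 / 2) (pi * y / 6)"

text \<open>Convergence of both series is part of the expansion, so that no junk value of
  \<^const>\<open>infsum\<close> can occur.\<close>

definition has_harmonic_expansion ::
  "real \<Rightarrow> (complex \<Rightarrow> complex) \<Rightarrow> (int \<Rightarrow> complex) \<Rightarrow> (int \<Rightarrow> complex) \<Rightarrow> bool" where
  "has_harmonic_expansion k f a_plus a_minus \<longleftrightarrow>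
     (\<forall>z\<in>upper_half_plane.
        (\<lambda>n. a_plus n * q_pow (of_int n / 24) z) summable_on {n. [n = 1] (mod 24)} \<and>
        (\<lambda>n. a_minus n * inc_Gamma (1 - k) (pi * of_int n * Im z / 6) * q_pow (- of_int n / 24) z)
          summable_on {n. [n = - 1] (mod 24)} \<and>
        f z = (\<Sum>\<^sub>\<infinity>n\<in>{n. [n = 1] (mod 24)}. a_plus n * q_pow (of_int n / 24) z)
            + (\<Sum>\<^sub>\<infinity>n\<in>{n. [n = - 1] (mod 24)}.
                 a_minus n * inc_Gamma (1 - k) (pi * of_int n * Im z / 6)
                   * q_pow (- of_int n / 24) z))"

definition weak_harmonic_forms :: "real \<Rightarrow> (complex \<Rightarrow> complex) set" where
  "weak_harmonic_forms k =
     {f. real_analytic_on f upper_half_plane \<and>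
         (\<forall>a b c d. a * d - b * c = 1 \<longrightarrow>
            (\<forall>z\<in>upper_half_plane.
               f (moebius_int a b c d z) =
                 eta_multiplier a b c d * (of_int c * z + of_int d) powr (of_real k) * f z)) \<and>
         (\<forall>z\<in>upper_half_plane. hyperbolic_laplacian k f z = 0) \<and>
         (\<exists>a_plus a_minus. has_harmonic_expansion k f a_plus a_minus \<and>
            finite {n. n \<le> 0 \<and> [n = 1] (mod 24) \<and> a_plus n \<noteq> 0} \<and>
            finite {n. n \<le> 0 \<and> [n = - 1] (mod 24) \<and> a_minus n \<noteq> 0})}"

text \<open>\<open>is_h_form m h p_plus p_minus\<close>: \<open>h\<close> is the form \<open>h\<^sub>m\<close>, and \<open>p_plus n\<close>, \<open>p_minus n\<close> are its
  coefficients \<open>p\<^sub>m\<^sup>+(n)\<close>, \<open>p\<^sub>m\<^sup>-(n)\<close>; only their values at the indices \<open>n\<close> occurring in the two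
  sums are relevant.\<close>

definition is_h_form ::
  "int \<Rightarrow> (complex \<Rightarrow> complex) \<Rightarrow> (int \<Rightarrow> complex) \<Rightarrow> (int \<Rightarrow> complex) \<Rightarrow> bool" where
  "is_h_form m h p_plus p_minus \<longleftrightarrow>
     h \<in> weak_harmonic_forms (5 / 2) \<and>
     (\<forall>z\<in>upper_half_plane.
        (\<lambda>n. p_plus n * q_pow (of_int n / 24) z) summable_on {n. 0 < n \<and> [n = 1] (mod 24)} \<and>
        (\<lambda>n. p_minus n * beta_fun (of_int n * Im z) * q_pow (- of_int n / 24) z)
          summable_on {n. 0 < n \<and> [n = - 1] (mod 24)} \<and>
        h z = (\<Sum>\<^sub>\<infinity>n\<in>{n. 0 < n \<and> [n = 1] (mod 24)}. p_plus n * q_pow (of_int n / 24) z)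
            + \<i> * beta_fun (- of_int m * Im z) * q_pow (of_int m / 24) z
            + (\<Sum>\<^sub>\<infinity>n\<in>{n. 0 < n \<and> [n = - 1] (mod 24)}.
                 p_minus n * beta_fun (of_int n * Im z) * q_pow (- of_int n / 24) z))"

end

theory Submission
  imports Defs "HOL-Real_Asymp.Real_Asymp"
begin

text \<open>
  Write the form \<open>h\<^sub>m\<close> as its Fourier series. Differentiating termwise,
  \<open>\<partial>h\<^sub>m/\<partial>(cnj z)\<close> is a constant times \<open>y\<close> to the power \<open>- 5 / 2\<close> times the conjugate of a
  holomorphic function \<open>g\<^sub>m\<close> (the shadow), which has weight \<open>- 1 / 2\<close>, the conjugate multiplier
  and principal part a multiple of \<open>q\<close> to the power \<open>- m / 24\<close>. A form of negative weight without
  principal part vanishes, so \<open>g\<^sub>m\<close> has real coefficients, i.e. it is fixed by the reflection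
  \<open>z \<mapsto> - cnj z\<close>. Therefore \<open>h\<^sub>n g\<^sub>m dz\<close> minus the reflection of \<open>h\<^sub>m g\<^sub>n dz\<close> is a closed
  one-form on the half plane, and it is invariant under \<open>SL(2, Z)\<close>. A primitive changes by a constant
  under each group element; the constants of \<open>z \<mapsto> - 1 / z\<close> and \<open>z \<mapsto> - 1 / (z + 1)\<close> vanish because
  these maps have fixed points, so the primitive is periodic and the integral of the one-form over a
  horizontal segment of length 1 is zero. Computing this integral from the Fourier series leaves the asserted
  identity. The only information needed about the multiplier \<open>\<epsilon>\<close> of \<open>z \<mapsto> - 1 / z\<close> is
  \<open>\<epsilon>\<^sup>2 \<i> = 1\<close>, which holds because that map is an involution and the form is not zero.
\<close>

subsection \<open>The incomplete Gamma function\<close>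

text \<open>Why two products and a reflection: up to a constant, the \<open>cnj z\<close>-derivative
  of \<open>h_n g_m\<close> is \<open>y powr (- 5 / 2) * cnj g_n * g_m\<close>. This is not
  symmetric in \<open>m\<close> and \<open>n\<close>, but exchanging the indices amounts to
  conjugating the product of shadows, and the reflection does exactly that once the shadows are
  known to be real. The difference is then closed on the whole half plane, which is convex, so a
  global primitive replaces Stokes on a truncated fundamental domain. What the integral sees: the
  principal part \<open>m powr (- 3 / 2)\<close> times \<open>q\<close> to the power
  \<open>- m / 24\<close> of \<open>g_m\<close> extracts from \<open>h_n\<close> its coefficient at
  \<open>m\<close>; the other terms of \<open>g_m\<close> meet the nonholomorphic terms of
  \<open>h_n\<close> and give products of one minus-coefficient of each form, symmetric in
  \<open>m\<close> and \<open>n\<close> by reality, so they cancel. The exponent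
  \<open>- 3 / 2\<close> comes from the chain rule applied to
  \<open>\<Gamma>(- 3 / 2, pi * m * y / 6)\<close>, and the factor \<open>\<i>\<close> before
  \<open>\<beta>(- m * y)\<close> is what makes the principal part of the shadow real.\<close>

definition upper_Gamma :: "real \<Rightarrow> real \<Rightarrow> real" where
  "upper_Gamma s x = integral {x..} (\<lambda>t. exp (- t) * t powr (s - 1))"

lemma upper_Gamma_integrable:
  assumes "0 < x" "s \<le> 1"
  shows "(\<lambda>t. exp (- t) * t powr (s - 1) :: real) integrable_on {x..}"
proof (rule measurable_bounded_by_integrable_imp_integrable)
  show "(\<lambda>t. exp (- t) * t powr (s - 1) :: real) \<in> borel_measurable (lebesgue_on {x..})"
    using assms by (intro continuous_imp_measurable_on_sets_lebesgue continuous_intros) auto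
  show "(\<lambda>t. x powr (s - 1) * exp (-1 * t)) integrable_on {x..}"
    by (intro integrable_on_mult_right integrable_on_exp_minus_to_infinity) auto
  show "norm (exp (- t) * t powr (s - 1)) \<le> x powr (s - 1) * exp (- 1 * t)" if "t \<in> {x..}" for t
    using that assms powr_mono2'[of "s - 1" x t] by (auto simp: mult.commute)
qed auto

lemma upper_Gamma_has_integral:
  assumes "0 < x" "s \<le> 1"
  shows "((\<lambda>t. exp (- t) * t powr (s - 1)) has_integral upper_Gamma s x) {x..}"
  unfolding upper_Gamma_def using upper_Gamma_integrable[OF assms] by (rule integrable_integral)

lemma upper_Gamma_split:
  assumes "0 < x" "x \<le> y" "s \<le> 1"
  shows "upper_Gamma s x = integral {x..y} (\<lambda>t. exp (- t) * t powr (s - 1)) + upper_Gamma s y"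
proof -
  let ?f = "\<lambda>t::real. exp (- t) * t powr (s - 1)"
  have "?f integrable_on {x..y}"
    using assms by (intro integrable_continuous_real continuous_intros) auto
  then have "(?f has_integral integral {x..y} ?f + upper_Gamma s y) ({x..y} \<union> {y..})"
    using assms by (intro has_integral_Un upper_Gamma_has_integral integrable_integral)
      (auto intro: negligible_subset[of "{y}"])
  moreover have "{x..y} \<union> {y..} = {x..}" using assms by auto
  ultimately show ?thesis by (simp add: integral_unique upper_Gamma_def[of s x])
qed

lemma upper_Gamma_DERIV:
  assumes "0 < x" "s \<le> 1"
  shows "(upper_Gamma s has_real_derivative - (exp (- x) * x powr (s - 1))) (at x)"
proof -
  let ?f = "\<lambda>t::real. exp (- t) * t powr (s - 1)"
  define a where "a = x / 2"
  have a: "0 < a" "a < x" using assms by (auto simp: a_def)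
  have "((\<lambda>u. integral {a..u} ?f) has_real_derivative ?f x) (at x within {a..x+1})"
    using a assms by (intro integral_has_real_derivative continuous_intros) auto
  then have "((\<lambda>u. integral {a..u} ?f) has_real_derivative ?f x) (at x)"
    using a at_within_interior[of x "{a..x+1}"] by (simp add: interior_atLeastAtMost_real)
  then have "((\<lambda>u. upper_Gamma s a - integral {a..u} ?f) has_real_derivative 0 - ?f x) (at x)"
    by (intro DERIV_diff DERIV_const)
  then have "(upper_Gamma s has_real_derivative 0 - ?f x) (at x)"
  proof (rule has_field_derivative_transform_within_open[of _ _ _ "{a<..}"])
    show "upper_Gamma s a - integral {a..u} ?f = upper_Gamma s u" if "u \<in> {a<..}" for u
      using upper_Gamma_split[of a u s] that a assms by auto
  qed (use a in auto)
  then show ?thesis by simp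
qed

lemma upper_Gamma_nonneg: "0 \<le> upper_Gamma s x"
  unfolding upper_Gamma_def by (cases "(\<lambda>t. exp (- t) * t powr (s - 1)) integrable_on {x..}")
    (auto intro!: integral_nonneg simp: not_integrable_integral)

lemma upper_Gamma_upper_bound:
  assumes "0 < x" "s \<le> 1"
  shows "upper_Gamma s x \<le> x powr (s - 1) * exp (- x)"
proof -
  have "((\<lambda>t. x powr (s - 1) * exp (-1 * t)) has_integral x powr (s - 1) * (exp (-1 * x) / 1)) {x..}"
    by (intro has_integral_mult_right has_integral_exp_minus_to_infinity) auto
  moreover have "exp (- t) * t powr (s - 1) \<le> x powr (s - 1) * exp (- 1 * t)" if "t \<in> {x..}" for t
    using that assms powr_mono2'[of "s - 1" x t] by (auto simp: mult.commute)
  ultimately have "upper_Gamma s x \<le> x powr (s - 1) * (exp (-1 * x) / 1)"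
    by (rule has_integral_le[OF upper_Gamma_has_integral[OF assms]])
  then show ?thesis by simp
qed

text \<open>Only the part of the integral over \<open>{x..x+1}\<close> is kept. A lower bound is
  wanted because the growth of the minus-coefficients is deduced from convergence of a series in
  which they are multiplied by \<open>upper_Gamma\<close>.\<close>

lemma upper_Gamma_lower_bound:
  assumes "0 < x" "s \<le> 1"
  shows "(x + 1) powr (s - 1) * exp (- (x + 1)) \<le> upper_Gamma s x"
proof -
  let ?f = "\<lambda>t::real. exp (- t) * t powr (s - 1)"
  have i: "?f integrable_on {x..x+1}"
    using assms by (intro integrable_continuous_real continuous_intros) auto
  have "((\<lambda>t. exp (- (x + 1)) * (x + 1) powr (s - 1)) has_integral
      (exp (- (x + 1)) * (x + 1) powr (s - 1))) {x..x+1}"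
    using has_integral_const_real[of _ x "x + 1"] by simp
  moreover have "exp (- (x + 1)) * (x + 1) powr (s - 1) \<le> ?f t" if "t \<in> {x..x+1}" for t
    using that assms powr_mono2'[of "s - 1" t "x+1"] by (intro mult_mono) auto
  ultimately have "exp (- (x + 1)) * (x + 1) powr (s - 1) \<le> integral {x..x+1} ?f"
    by (rule has_integral_le[OF _ integrable_integral[OF i]])
  then show ?thesis
    using upper_Gamma_split[of x "x+1" s] upper_Gamma_nonneg[of s "x+1"] assms by (simp add: mult.commute)
qed

lemma integral_incomplete_Gamma:
  assumes "0 < x" "s \<le> 1"
  shows "integral {x..} (\<lambda>t. exp (- complex_of_real t) * complex_of_real t powr (of_real s - 1))
    = of_real (upper_Gamma s x)"
proof (rule integral_unique)
  have "((\<lambda>t. complex_of_real (exp (- t) * t powr (s - 1))) has_integral of_real (upper_Gamma s x)) {x..}"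
    by (intro has_integral_of_real upper_Gamma_has_integral assms)
  moreover have "complex_of_real (exp (- t) * t powr (s - 1))
      = exp (- complex_of_real t) * complex_of_real t powr (of_real s - 1)" if "t \<in> {x..}" for t
    using that assms powr_of_real[of t "s - 1"] exp_of_real[of "- t", where ?'a = complex] by auto
  ultimately show "((\<lambda>t. exp (- complex_of_real t) * complex_of_real t powr (of_real s - 1))
      has_integral of_real (upper_Gamma s x)) {x..}"
    by (rule has_integral_eq[rotated])
qed

lemma inc_Gamma_pos:
  assumes "0 < x" "s \<le> 1"
  shows "inc_Gamma s x = of_real (upper_Gamma s x)"
  using integral_incomplete_Gamma[OF assms] assms by (simp add: inc_Gamma_def)

text \<open>The integrand has a primitive along the path, so only the starting point
  \<open>- x\<close> matters, where the argument is \<open>pi\<close>; this is the source of the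
  phase.\<close>

lemma inc_Gamma_neg_has_vector_derivative:
  assumes "0 < x" "s \<le> 1"
  shows "((\<lambda>x. inc_Gamma s (- x)) has_vector_derivative
    of_real (exp x * x powr (s - 1)) * cis (pi * (s - 1))) (at x)"
proof -
  \<comment> \<open>The cut of the principal branch passes through the starting point
    \<open>- x\<close>. With \<open>t = \<i> * u\<close>, the closed upper half plane without 0
    becomes the closed right half plane without 0, away from the cut in \<open>u\<close>;
    \<open>G u\<close> is the integrand rewritten for \<open>du\<close>.\<close>
  define G where "G = (\<lambda>u. exp (- (\<i> * u)) * exp (of_real (s - 1) * (Ln u + \<i> * of_real (pi / 2))) * \<i>)"
  let ?S = "- (\<real>\<^sub>\<le>\<^sub>0 :: complex set)"
  have "\<exists>F. \<forall>u\<in>?S. (F has_field_derivative G u) (at u)"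
  proof (rule holomorphic_starlike_primitive[where k = "{}"])
    have "G holomorphic_on ?S" unfolding G_def by (intro holomorphic_intros) auto
    then show "continuous_on ?S G" "\<And>x. x \<in> ?S - {} \<Longrightarrow> G field_differentiable at x"
      by (auto intro: holomorphic_on_imp_continuous_on
          holomorphic_on_imp_differentiable_at[of G ?S] closed_nonpos_Reals_complex)
    have "?S = - (complex_of_real ` {..0})"
      by (auto simp: nonpos_Reals_def elim!: Reals_cases)
    then show "starlike ?S" using starlike_slotted_complex_plane_left[of 0] by simp
  qed (auto intro: closed_nonpos_Reals_complex)
  then obtain F where F: "\<And>u. u \<in> ?S \<Longrightarrow> (F has_field_derivative G u) (at u)" by blast
  define g where "g = (\<lambda>t. exp (- t) * t powr (complex_of_real s - 1))"
  have gG: "G (- \<i> * t) * (- \<i>) = g t" and tS: "- \<i> * t \<in> ?S" if "0 \<le> Im t" "t \<noteq> 0" for t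
  proof -
    have "Re (- \<i> * t) > 0 \<or> Im (- \<i> * t) \<noteq> 0"
      using that by (auto simp: complex_eq_iff)
    then show "- \<i> * t \<in> ?S" by (auto simp: complex_nonpos_Reals_iff)
    have "Ln (- \<i> * t) = Ln t - \<i> * of_real pi / 2"
    proof -
      have "0 \<le> Im (Ln t)" "Im (Ln t) \<le> pi" using that Im_Ln_pos_le[of t] by auto
      then have "\<not> Im (Ln (- \<i>) + Ln t) \<le> - pi" "\<not> pi < Im (Ln (- \<i>) + Ln t)"
        using pi_gt_zero by (simp_all, linarith+)
      then show ?thesis
        using Ln_times[of "- \<i>" t] that by auto
    qed
    then have eq: "Ln (- \<i> * t) + \<i> * of_real (pi / 2) = Ln t" by simp
    show "G (- \<i> * t) * (- \<i>) = g t"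
      unfolding G_def eq using that by (simp add: g_def powr_def mult.assoc)
  qed
  have F': "((\<lambda>t. F (- \<i> * t)) has_field_derivative g t) (at t)" if "0 \<le> Im t" "t \<noteq> 0" for t
  proof -
    have "((\<lambda>t. F (- \<i> * t)) has_field_derivative G (- \<i> * t) * (- \<i>)) (at t)"
      by (rule DERIV_chain2[where f = F and g = "\<lambda>t. - \<i> * t", OF F[OF tS[OF that]]]) (auto intro!: derivative_eq_intros)
    then show ?thesis using gG[OF that] by simp
  qed
  have eq: "inc_Gamma s (- y) = F (- \<i> * of_real y) - F (- \<i> * (- of_real y)) + of_real (upper_Gamma s y)"
    if "0 < y" for y
  proof -
    have "path_image (part_circlepath 0 y pi 0) \<subseteq> {t. 0 \<le> Im t \<and> t \<noteq> 0}"
    proof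
      fix t assume "t \<in> path_image (part_circlepath 0 y pi 0)"
      then obtain x where x: "0 \<le> x" "x \<le> 1" and t: "t = of_real y * exp (\<i> * of_real ((1 - x) * pi))"
        by (auto simp: path_image_def part_circlepath_def linepath_def)
      have "0 \<le> sin ((1 - x) * pi)" using x by (intro sin_ge_zero) (auto simp: mult_left_le_one_le)
      then show "t \<in> {t. 0 \<le> Im t \<and> t \<noteq> 0}" using that
        by (simp add: t Im_exp)
    qed
    then have "(g has_contour_integral F (- \<i> * pathfinish (part_circlepath 0 y pi 0))
        - F (- \<i> * pathstart (part_circlepath 0 y pi 0))) (part_circlepath 0 y pi 0)"
      by (intro contour_integral_primitive[of "{t. 0 \<le> Im t \<and> t \<noteq> 0}" "\<lambda>t. F (- \<i> * t)" g]
          has_field_derivative_at_within[OF F']) auto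
    then have "contour_integral (part_circlepath 0 y pi 0) g = F (- \<i> * of_real y) - F (- \<i> * (- of_real y))"
      by (simp add: contour_integral_unique)
    then show ?thesis
      using that integral_incomplete_Gamma[OF that assms(2)] by (simp add: inc_Gamma_def g_def)
  qed
  \<comment> \<open>Both ends of the semicircle move with \<open>y\<close>. The contribution of the
    end on the positive axis cancels the derivative of \<open>upper_Gamma\<close>; the one at
    \<open>- x\<close> remains.\<close>
  have "((\<lambda>y. F (- \<i> * of_real y) - F (- \<i> * (- of_real y)) + of_real (upper_Gamma s y))
      has_vector_derivative g (of_real x) - (- g (- of_real x)) + of_real (- (exp (- x) * x powr (s - 1)))) (at x)"
  proof (intro has_vector_derivative_add has_vector_derivative_diff)
    show "((\<lambda>y. F (- \<i> * of_real y)) has_vector_derivative g (of_real x)) (at x)"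
      using F'[of "of_real x"] assms by (auto dest: has_vector_derivative_real_field)
    have "((\<lambda>t. F (- \<i> * (- t))) has_field_derivative g (- of_real x) * (- 1)) (at (of_real x))"
      by (rule DERIV_chain2[where f = "\<lambda>t. F (- \<i> * t)" and g = uminus, OF F'[of "- of_real x"]]) (use assms in \<open>auto intro!: derivative_eq_intros\<close>)
    then show "((\<lambda>y. F (- \<i> * (- of_real y))) has_vector_derivative - g (- of_real x)) (at x)"
      by (auto dest: has_vector_derivative_real_field)
    show "((\<lambda>y. complex_of_real (upper_Gamma s y)) has_vector_derivative
        of_real (- (exp (- x) * x powr (s - 1)))) (at x)"
      using upper_Gamma_DERIV[OF assms]
      by (intro has_vector_derivative_of_real) (simp add: has_real_derivative_iff_has_vector_derivative)
  qed
  moreover have "g (of_real x) = of_real (exp (- x) * x powr (s - 1))"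
    using assms powr_of_real[of x "s - 1"] exp_of_real[of "- x", where ?'a = complex]
    by (simp add: g_def)
  moreover have "g (- of_real x) = of_real (exp x * x powr (s - 1)) * cis (pi * (s - 1))"
  proof -
    have "Ln (- complex_of_real x) = of_real (ln x) + \<i> * of_real pi"
      using assms Ln_minus[of "of_real x"] by (simp add: Ln_of_real)
    then have "(- complex_of_real x) powr (of_real s - 1)
        = exp (of_real ((s - 1) * ln x)) * exp (\<i> * of_real (pi * (s - 1)))"
      using assms by (simp add: powr_def algebra_simps flip: exp_add)
    then show ?thesis
      using assms exp_of_real[of "(s - 1) * ln x", where ?'a = complex]
      by (simp add: g_def cis_conv_exp exp_of_real powr_def)
  qed
  ultimately have "((\<lambda>y. F (- \<i> * of_real y) - F (- \<i> * (- of_real y)) + of_real (upper_Gamma s y))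
      has_vector_derivative of_real (exp x * x powr (s - 1)) * cis (pi * (s - 1))) (at x)"
    by simp
  then show ?thesis
    by (rule has_vector_derivative_transform_within_open[where S = "{0<..}"]) (use assms eq in auto)
qed

subsection \<open>Termwise differentiation and integration\<close>

text \<open>A real derivative written as \<open>a * v + b * cnj v\<close> displays both Wirtinger
  derivatives: \<open>a\<close> with respect to \<open>z\<close> and \<open>b\<close> with respect
  to \<open>cnj z\<close>. Since \<open>cnj\<close> preserves norms, uniform convergence of the two
  coefficient series controls the error in operator norm.\<close>

lemma suminf_has_derivative_cnj:
  fixes f a b :: "nat \<Rightarrow> complex \<Rightarrow> complex"
  assumes S: "open S" "convex S" "z \<in> S"
    and der: "\<And>j z. z \<in> S \<Longrightarrow> (f j has_derivative (\<lambda>v. a j z * v + b j z * cnj v)) (at z)"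
    and bd: "\<And>j z. z \<in> S \<Longrightarrow> norm (f j z) \<le> M j"
      "\<And>j z. z \<in> S \<Longrightarrow> norm (a j z) \<le> M j" "\<And>j z. z \<in> S \<Longrightarrow> norm (b j z) \<le> M j"
    and M: "summable M"
  shows "((\<lambda>z. \<Sum>j. f j z) has_derivative (\<lambda>v. (\<Sum>j. a j z) * v + (\<Sum>j. b j z) * cnj v)) (at z)"
proof -
  let ?d = "\<lambda>j z v. a j z * v + b j z * cnj v"
  let ?D = "\<lambda>z v. (\<Sum>j. a j z) * v + (\<Sum>j. b j z) * cnj v"
  have ua: "uniform_limit S (\<lambda>n x. \<Sum>i<n. a i x) (\<lambda>x. \<Sum>i. a i x) sequentially"
    and ub: "uniform_limit S (\<lambda>n x. \<Sum>i<n. b i x) (\<lambda>x. \<Sum>i. b i x) sequentially"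
    by (rule Weierstrass_m_test[OF bd(2) M] Weierstrass_m_test[OF bd(3) M]; assumption)+
  have "\<exists>g. \<forall>x\<in>S. (\<lambda>n. f n x) sums g x \<and> (g has_derivative ?D x) (at x within S)"
  proof (rule has_derivative_series[where f' = ?d])
    show "convex S" by fact
    show "(f n has_derivative ?d n x) (at x within S)" if "x \<in> S" for n x
      using der[OF that] by (rule has_derivative_at_withinI)
    show "z \<in> S" by fact
    show "(\<lambda>n. f n z) sums (\<Sum>n. f n z)"
      using bd(1)[OF S(3)] M by (auto intro: summable_sums summable_comparison_test)
    fix e :: real assume e: "0 < e"
    then have "\<forall>\<^sub>F n in sequentially. \<forall>x\<in>S. dist (\<Sum>i<n. a i x) (\<Sum>i. a i x) < e / 2"
      "\<forall>\<^sub>F n in sequentially. \<forall>x\<in>S. dist (\<Sum>i<n. b i x) (\<Sum>i. b i x) < e / 2"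
      using uniform_limitD[OF ua, of "e/2"] uniform_limitD[OF ub, of "e/2"] by auto
    then show "\<forall>\<^sub>F n in sequentially. \<forall>x\<in>S. \<forall>h. norm ((\<Sum>i<n. ?d i x h) - ?D x h) \<le> e * norm h"
    proof eventually_elim
      case (elim n)
      show ?case
      proof (intro ballI allI)
        fix x h assume x: "x \<in> S"
        have "(\<Sum>i<n. ?d i x h) - ?D x h
            = ((\<Sum>i<n. a i x) - (\<Sum>i. a i x)) * h + ((\<Sum>i<n. b i x) - (\<Sum>i. b i x)) * cnj h"
          by (simp add: sum.distrib sum_distrib_right left_diff_distrib)
        also have "norm \<dots> \<le> norm ((\<Sum>i<n. a i x) - (\<Sum>i. a i x)) * norm h
            + norm ((\<Sum>i<n. b i x) - (\<Sum>i. b i x)) * norm h"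
          by (rule order_trans[OF norm_triangle_ineq]) (simp add: norm_mult)
        also have "\<dots> \<le> e / 2 * norm h + e / 2 * norm h"
          using elim x by (intro add_mono mult_right_mono) (auto simp: dist_norm less_imp_le)
        finally show "norm ((\<Sum>i<n. ?d i x h) - ?D x h) \<le> e * norm h" by (simp add: field_simps)
      qed
    qed
  qed
  then obtain g where g: "\<And>x. x \<in> S \<Longrightarrow> (\<lambda>n. f n x) sums g x"
    "\<And>x. x \<in> S \<Longrightarrow> (g has_derivative ?D x) (at x within S)" by blast
  then have "(g has_derivative ?D z) (at z)"
    using g(2)[OF S(3)] at_within_open[of z S] S by simp
  then show ?thesis
    by (rule has_derivative_transform_within_open[of _ _ _ _ S]) (use S g sums_unique in auto)
qed

lemma continuous_on_suminf_bounded: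
  fixes f :: "nat \<Rightarrow> complex \<Rightarrow> complex"
  assumes "\<And>j. continuous_on S (f j)" "\<And>j z. z \<in> S \<Longrightarrow> norm (f j z) \<le> M j" "summable M"
  shows "continuous_on S (\<lambda>z. \<Sum>j. f j z)"
  by (rule uniform_limit_theorem[OF _ Weierstrass_m_test[OF assms(2,3)]])
    (auto intro!: always_eventually continuous_intros assms(1))

text \<open>The factor \<open>\<phi>\<close> is an arbitrary continuous function: a character yields
  Fourier coefficients, and a whole form on a horizontal segment yields the integral of a product of
  two expansions without a double series.\<close>

lemma integral_suminf_mult:
  fixes a :: "nat \<Rightarrow> complex" and u :: "nat \<Rightarrow> real \<Rightarrow> complex"
  assumes a: "summable (\<lambda>j. norm (a j))"
    and u: "\<And>j. continuous_on {0..1} (u j)" "\<And>j x. norm (u j x) \<le> 1"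
    and \<phi>: "continuous_on {0..1} \<phi>"
  shows "((\<lambda>x. (\<Sum>j. a j * u j x) * \<phi> x) has_integral
           (\<Sum>j. a j * integral {0..1} (\<lambda>x. u j x * \<phi> x))) {0..1}"
proof -
  have "compact (\<phi> ` {0..1})" by (intro compact_continuous_image \<phi> compact_Icc)
  then obtain C where C: "\<And>x. x \<in> {0..1} \<Longrightarrow> norm (\<phi> x) \<le> C"
    by (metis compact_imp_bounded bounded_iff image_eqI)
  have "uniform_limit {0..1} (\<lambda>n x. \<Sum>j<n. a j * u j x * \<phi> x) (\<lambda>x. \<Sum>j. a j * u j x * \<phi> x) sequentially"
  proof (rule Weierstrass_m_test)
    show "summable (\<lambda>j. norm (a j) * C)" using a by (rule summable_mult2)
    fix j and x :: real assume "x \<in> {0..1}"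
    then have "norm (a j) * norm (u j x) * norm (\<phi> x) \<le> norm (a j) * 1 * C"
      using u(2) C by (intro mult_mono) auto
    then show "norm (a j * u j x * \<phi> x) \<le> norm (a j) * C" by (simp add: norm_mult)
  qed
  moreover have "continuous_on {0..1} (\<lambda>x. \<Sum>j<n. a j * u j x * \<phi> x)" for n
    by (intro continuous_intros u \<phi>)
  ultimately obtain I J where I: "\<And>n. ((\<lambda>x. \<Sum>j<n. a j * u j x * \<phi> x) has_integral I n) {0..1}"
    and J: "((\<lambda>x. \<Sum>j. a j * u j x * \<phi> x) has_integral J) {0..1}" and IJ: "I \<longlonglongrightarrow> J"
    by (rule uniform_limit_integral[OF _ _ sequentially_bot]) blast
  have "((\<lambda>x. \<Sum>j<n. a j * u j x * \<phi> x) has_integral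
      (\<Sum>j<n. a j * integral {0..1} (\<lambda>x. u j x * \<phi> x))) {0..1}" for n
    unfolding mult.assoc
    by (intro has_integral_sum has_integral_mult_right integrable_integral
        integrable_continuous_real continuous_intros u \<phi>) auto
  then have "I = (\<lambda>n. \<Sum>j<n. a j * integral {0..1} (\<lambda>x. u j x * \<phi> x))"
    using I has_integral_unique by blast
  with IJ have s: "(\<lambda>j. a j * integral {0..1} (\<lambda>x. u j x * \<phi> x)) sums J" by (simp add: sums_def)
  have "(\<Sum>j. a j * u j x * \<phi> x) = (\<Sum>j. a j * u j x) * \<phi> x" if "x \<in> {0..1}" for x
  proof -
    have "norm (a j * u j x) \<le> norm (a j)" for j
      using mult_left_mono[OF u(2)[of j x] norm_ge_zero[of "a j"]] by (simp add: norm_mult)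
    then have "summable (\<lambda>j. a j * u j x)"
      by (intro summable_comparison_test'[OF a]) auto
    then show ?thesis by (simp add: suminf_mult2)
  qed
  then show "((\<lambda>x. (\<Sum>j. a j * u j x) * \<phi> x) has_integral
           (\<Sum>j. a j * integral {0..1} (\<lambda>x. u j x * \<phi> x))) {0..1}"
    using has_integral_eq[OF _ J] sums_unique[OF s] by simp
qed

lemma integral_cis_int:
  fixes k :: int
  shows "integral {0..1} (\<lambda>x. cis (2 * pi * of_int k * x)) = (if k = 0 then 1 else 0)"
proof (cases "k = 0")
  case False
  have "((\<lambda>x. cis (2 * pi * of_int k * x)) has_integral
      cis (2 * pi * of_int k * 1) / (2 * pi * \<i> * of_int k)
      - cis (2 * pi * of_int k * 0) / (2 * pi * \<i> * of_int k)) {0..1}"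
  proof (rule fundamental_theorem_of_calculus)
    fix x :: real
    have "((\<lambda>w. exp (\<i> * (2 * of_real pi * of_int k * w)) / (2 * pi * \<i> * of_int k))
      has_field_derivative exp (\<i> * (2 * of_real pi * of_int k * of_real x))) (at (of_real x))"
      using False by (auto intro!: derivative_eq_intros)
    then have "((\<lambda>x. exp (\<i> * (2 * of_real pi * of_int k * of_real x)) / (2 * pi * \<i> * of_int k))
      has_vector_derivative exp (\<i> * (2 * of_real pi * of_int k * of_real x))) (at x within {0..1})"
      by (auto dest!: has_vector_derivative_real_field intro: has_vector_derivative_at_within)
    then show "((\<lambda>x. cis (2 * pi * of_int k * x) / (2 * pi * \<i> * of_int k))
      has_vector_derivative cis (2 * pi * of_int k * x)) (at x within {0..1})"
      by (simp add: cis_conv_exp)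
  qed auto
  moreover have "cis (2 * pi * of_int k) = 1"
    using cis_multiple_2pi[of "of_int k"] by simp
  ultimately show ?thesis using False by (simp add: integral_unique)
qed auto

subsection \<open>Closed forms on convex sets\<close>

text \<open>Poincare lemma for \<open>P dz + Q d(cnj z)\<close>. Closedness is expressed by the
  shared \<open>r\<close>: the \<open>cnj z\<close>-derivative of \<open>P\<close> equals the
  \<open>z\<close>-derivative of \<open>Q\<close>. The primitive integrates along segments from a
  base point.\<close>

lemma closed_form_primitive:
  fixes P Q p r q :: "complex \<Rightarrow> complex"
  assumes S: "open S" "convex S" "S \<noteq> {}"
    and P: "\<And>z. z \<in> S \<Longrightarrow> (P has_derivative (\<lambda>v. p z * v + r z * cnj v)) (at z)"
    and Q: "\<And>z. z \<in> S \<Longrightarrow> (Q has_derivative (\<lambda>v. r z * v + q z * cnj v)) (at z)"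
    and cont: "continuous_on S p" "continuous_on S r" "continuous_on S q"
  shows "\<exists>W. \<forall>z\<in>S. (W has_derivative (\<lambda>v. P z * v + Q z * cnj v)) (at z)"
proof -
  obtain a where a: "a \<in> S" using S by auto
  define w where "w = (\<lambda>z t. a + of_real t * (z - a))"
  have w: "w z t \<in> S" if "z \<in> S" "t \<in> {0..1}" for z t
  proof -
    have "(1 - t) *\<^sub>R a + t *\<^sub>R z \<in> S" using that a S by (auto intro: convexD_alt)
    then show ?thesis by (simp add: w_def scaleR_conv_of_real algebra_simps)
  qed
  have cP: "continuous_on S P" and cQ: "continuous_on S Q"
    using P Q by (auto intro!: continuous_at_imp_continuous_on has_derivative_continuous)
  let ?f = "\<lambda>z t. P (w z t) * (z - a) + Q (w z t) * cnj (z - a)"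
  \<comment> \<open>\<open>A\<close> and \<open>B\<close> play two roles: they are the
    \<open>t\<close>-derivatives of \<open>t * P (w z t)\<close> and \<open>t * Q (w z t)\<close>,
    and also the coefficients of \<open>v\<close> and \<open>cnj v\<close> in the
    \<open>z\<close>-derivative of the integrand \<open>?f\<close>. The roles agree because
    \<open>r\<close> is shared, so the integral over \<open>t\<close> telescopes to
    \<open>P z\<close> and \<open>Q z\<close>.\<close>
  define A where "A = (\<lambda>z t. of_real t * (p (w z t) * (z - a) + r (w z t) * cnj (z - a)) + P (w z t))"
  define B where "B = (\<lambda>z t. of_real t * (r (w z t) * (z - a) + q (w z t) * cnj (z - a)) + Q (w z t))"
  define cj where "cj = Blinfun cnj"
  have cj: "blinfun_apply cj = cnj"
    unfolding cj_def by (rule bounded_linear_Blinfun_apply[OF bounded_linear_cnj])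
  \<comment> \<open>Differentiation under the integral sign wants a continuous map into the space of
    bounded linear maps.\<close>
  define D where "D = (\<lambda>z t. blinfun_mult_right (A z t) + (blinfun_mult_right (B z t) o\<^sub>L cj))"
  have D: "blinfun_apply (D z t) v = A z t * v + B z t * cnj v" for z t v
    by (simp add: D_def blinfun.add_left cj)
  have cw: "continuous_on (S \<times> {0..1}) (\<lambda>x. w (fst x) (snd x))"
    unfolding w_def by (intro continuous_intros)
  have cc: "continuous_on (S \<times> {0..1}) (\<lambda>x. \<phi> (w (fst x) (snd x)))" if "continuous_on S \<phi>" for \<phi>
    by (rule continuous_on_compose2[OF that cw]) (auto intro: w)
  have cA: "continuous_on (S \<times> {0..1}) (\<lambda>x. A (fst x) (snd x))"
    and cB: "continuous_on (S \<times> {0..1}) (\<lambda>x. B (fst x) (snd x))"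
    unfolding A_def B_def by (intro continuous_intros cc cont cP cQ)+
  have cD: "continuous_on (S \<times> cbox 0 1) (\<lambda>(z, t). D z t)"
    unfolding D_def split_beta cbox_interval
    by (intro continuous_intros bounded_linear.continuous_on[OF bounded_linear_blinfun_mult_right] cA cB)
  have ct: "continuous_on {0..1} (\<lambda>t. \<phi> (w z t))" if "continuous_on S \<phi>" "z \<in> S" for \<phi> z
    by (rule continuous_on_compose2[OF that(1)]) (use w that in \<open>auto simp: w_def intro!: continuous_intros\<close>)
  have dw: "((\<lambda>t. w z t) has_vector_derivative (z - a)) (at t)" for z t
    unfolding w_def by (auto intro!: derivative_eq_intros)
  have dv: "((\<lambda>t. of_real t * \<phi> (w z t)) has_vector_derivative
      of_real t * (f1 (w z t) * (z - a) + f2 (w z t) * cnj (z - a)) + \<phi> (w z t)) (at t)"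
    if "\<And>z. z \<in> S \<Longrightarrow> (\<phi> has_derivative (\<lambda>v. f1 z * v + f2 z * cnj v)) (at z)" "z \<in> S" "t \<in> {0..1}"
    for \<phi> f1 f2 z t
  proof -
    have "((\<lambda>t. \<phi> (w z t)) has_derivative
        (\<lambda>h. f1 (w z t) * (h *\<^sub>R (z - a)) + f2 (w z t) * cnj (h *\<^sub>R (z - a)))) (at t)"
      using has_derivative_compose[OF dw[unfolded has_vector_derivative_def] that(1)[OF w[OF that(2,3)]]]
      by simp
    then have "((\<lambda>t. \<phi> (w z t)) has_vector_derivative
        f1 (w z t) * (z - a) + f2 (w z t) * cnj (z - a)) (at t)"
      unfolding has_vector_derivative_def by (simp add: scaleR_conv_of_real algebra_simps)
    then show ?thesis
      by (auto intro!: derivative_eq_intros simp: has_vector_derivative_def scaleR_conv_of_real algebra_simps)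
  qed
  have "((\<lambda>z. integral (cbox 0 1) (?f z)) has_derivative (\<lambda>v. P z * v + Q z * cnj v)) (at z)"
    if z: "z \<in> S" for z
  proof -
    have "((\<lambda>z. integral (cbox 0 1) (?f z)) has_derivative integral (cbox 0 1) (D z)) (at z within S)"
    proof (rule leibniz_rule[OF _ _ cD z S(2)])
      fix z t assume zt: "z \<in> S" "t \<in> cbox (0::real) 1"
      have dz: "((\<lambda>z. w z t) has_derivative (\<lambda>v. of_real t * v)) (at z)"
        unfolding w_def by (auto intro!: derivative_eq_intros)
      have wt: "w z t \<in> S" using w zt by auto
      have "((\<lambda>z. ?f z t) has_derivative
        (\<lambda>v. (P (w z t) * v + (p (w z t) * (of_real t * v) + r (w z t) * cnj (of_real t * v)) * (z - a))
          + (Q (w z t) * cnj v + (r (w z t) * (of_real t * v) + q (w z t) * cnj (of_real t * v)) * cnj (z - a)))) (at z)"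
        by (intro has_derivative_add has_derivative_mult has_derivative_compose[OF dz P[OF wt]]
            has_derivative_compose[OF dz Q[OF wt]] has_derivative_cnj)
           (auto intro!: derivative_eq_intros)
      also have "(\<lambda>v. (P (w z t) * v + (p (w z t) * (of_real t * v) + r (w z t) * cnj (of_real t * v)) * (z - a))
          + (Q (w z t) * cnj v + (r (w z t) * (of_real t * v) + q (w z t) * cnj (of_real t * v)) * cnj (z - a)))
          = blinfun_apply (D z t)"
        unfolding D A_def B_def by (intro ext) (simp add: algebra_simps)
      finally show "((\<lambda>z. ?f z t) has_derivative blinfun_apply (D z t)) (at z within S)"
        by (rule has_derivative_at_withinI)
    next
      fix z assume "z \<in> S"
      then show "?f z integrable_on cbox 0 1"
        unfolding cbox_interval by (intro integrable_continuous_real continuous_intros ct cP cQ)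
    qed
    moreover have eq: "integral (cbox 0 1) (D z) v = P z * v + Q z * cnj v" for v
    proof -
      have cDz: "continuous_on {0..1} (D z)"
        by (rule continuous_on_compose2[OF cD, of _ "\<lambda>t. (z, t)", simplified])
          (use z in \<open>auto intro!: continuous_intros\<close>)
      have "integral (cbox 0 1) (D z) v = integral {0..1} (\<lambda>t. D z t v)"
        using integral_linear[OF integrable_continuous_real[OF cDz] bounded_linear_apply_blinfun[of v]]
        by (simp add: o_def)
      also have "\<dots> = P z * v + Q z * cnj v"
      proof (rule integral_unique)
        have "(A z has_integral (of_real 1 * P (w z 1) - of_real 0 * P (w z 0))) {0..1}"
          unfolding A_def by (rule fundamental_theorem_of_calculus)
            (auto simp del: complex_cnj_diff intro!: has_vector_derivative_at_within[OF dv] P z)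
        moreover have "(B z has_integral (of_real 1 * Q (w z 1) - of_real 0 * Q (w z 0))) {0..1}"
          unfolding B_def by (rule fundamental_theorem_of_calculus)
            (auto simp del: complex_cnj_diff intro!: has_vector_derivative_at_within[OF dv] Q z)
        ultimately have "((\<lambda>t. A z t * v + B z t * cnj v) has_integral
            (of_real 1 * P (w z 1) - of_real 0 * P (w z 0)) * v
            + (of_real 1 * Q (w z 1) - of_real 0 * Q (w z 0)) * cnj v) {0..1}"
          by (intro has_integral_add has_integral_mult_left)
        then show "((\<lambda>t. D z t v) has_integral P z * v + Q z * cnj v) {0..1}"
          by (simp add: D w_def)
      qed
      finally show ?thesis .
    qed
    moreover have "blinfun_apply (integral (cbox 0 1) (D z)) = (\<lambda>v. P z * v + Q z * cnj v)"
      using eq by (rule ext)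
    ultimately show ?thesis
      using at_within_open[OF z S(1)] by simp
  qed
  then show ?thesis by blast
qed

subsection \<open>Forms of negative weight\<close>

text \<open>If the real part is at most 1/2 in modulus and the height is below 1/2, then
  \<open>norm w\<close> squared is at most 1/2, so inversion at least doubles the height; the
  induction counts doublings. Height 1/2 in place of the exact fundamental domain is enough to
  confine the search for a maximum to a compact set.\<close>

lemma translate_inversion_Im_ge:
  assumes inv: "\<And>z. 0 < Im z \<Longrightarrow> \<phi> (- 1 / z) = (\<phi> z :: real)"
    and per: "\<And>z. 0 < Im z \<Longrightarrow> \<phi> (z + 1) = \<phi> z"
    and z: "0 < Im z"
  shows "\<exists>w. \<bar>Re w\<bar> \<le> 1 / 2 \<and> 1 / 2 \<le> Im w \<and> \<phi> w = \<phi> z"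
proof -
  have shift: "\<exists>w. \<bar>Re w\<bar> \<le> 1 / 2 \<and> Im w = Im z \<and> \<phi> w = \<phi> z" if z: "0 < Im z" for z
  proof -
    have up: "\<phi> (z + of_nat n) = \<phi> z" if "0 < Im z" for z n
      by (induction n) (use that per[of "z + of_nat _"] in \<open>auto simp: add_ac\<close>)
    have int: "\<phi> (z + of_int k) = \<phi> z" for k
    proof (cases "0 \<le> k")
      case True
      then show ?thesis using up[OF z, of "nat k"] by simp
    next
      case False
      then show ?thesis using up[of "z + of_int k" "nat (- k)"] z by simp
    qed
    have "\<bar>Re (z + of_int (- round (Re z)))\<bar> \<le> 1 / 2"
      using of_int_round_abs_le[of "Re z"] by (simp add: abs_minus_commute)
    then show ?thesis using int[of "- round (Re z)"] by (intro exI[of _ "z + of_int (- round (Re z))"]) auto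
  qed
  have "\<exists>w. \<bar>Re w\<bar> \<le> 1 / 2 \<and> 1 / 2 \<le> Im w \<and> \<phi> w = \<phi> z" if "0 < Im z" "1 / 2 \<le> 2 ^ n * Im z" for n z
    using that
  proof (induction n arbitrary: z)
    case 0
    then show ?case using shift[of z] by auto
  next
    case (Suc n)
    obtain w where w: "\<bar>Re w\<bar> \<le> 1 / 2" "Im w = Im z" "\<phi> w = \<phi> z" using shift Suc.prems by blast
    show ?case
    proof (cases "1 / 2 \<le> Im w")
      case True
      then show ?thesis using w by blast
    next
      case False
      have "(Re w)\<^sup>2 \<le> (1 / 2)\<^sup>2" "(Im w)\<^sup>2 \<le> (1 / 2)\<^sup>2"
        using w False Suc.prems abs_le_square_iff[of "Re w" "1/2"] by (auto intro!: power_mono)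
      then have n2: "(Re w)\<^sup>2 + (Im w)\<^sup>2 \<le> 1 / 2" by (simp add: power2_eq_square)
      have pos: "0 < (Re w)\<^sup>2 + (Im w)\<^sup>2" using w Suc.prems by (simp add: sum_power2_gt_zero_iff)
      have "2 * Im w \<le> Im w / ((Re w)\<^sup>2 + (Im w)\<^sup>2)"
        using mult_left_mono[OF n2, of "2 * Im w"] pos w Suc.prems by (simp add: pos_le_divide_eq)
      then have im: "2 * Im z \<le> Im (- 1 / w)" using w by (simp add: Im_divide)
      have "1 / 2 \<le> 2 ^ n * (2 * Im z)" using Suc.prems by simp
      also have "\<dots> \<le> 2 ^ n * Im (- 1 / w)" using im by (intro mult_left_mono) auto
      finally obtain u where "\<bar>Re u\<bar> \<le> 1 / 2 \<and> 1 / 2 \<le> Im u \<and> \<phi> u = \<phi> (- 1 / w)"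
        using Suc.IH[of "- 1 / w"] im Suc.prems by fastforce
      then show ?thesis using inv[of w] w Suc.prems by auto
    qed
  qed
  moreover obtain n where "1 / (2 * Im z) < 2 ^ n" using real_arch_pow[of 2] by auto
  then have "1 / 2 \<le> 2 ^ n * Im z" using z by (simp add: field_simps)
  ultimately show ?thesis using z by blast
qed

text \<open>The invariant function \<open>y powr (k / 2) * norm (G z)\<close> attains its maximum. As \<open>ln\<close> is concave,
  \<open>y powr (k / 2)\<close> dominates the modulus of an exponential \<open>u\<close> that touches it at the maximum point,
  so the maximum modulus principle applies to \<open>G * u\<close>.\<close>

lemma negative_weight_cusp_form_eq_0:
  fixes G :: "complex \<Rightarrow> complex" and k :: real
  assumes hol: "G holomorphic_on {z. 0 < Im z}" and k: "k \<le> 0"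
    and inv: "\<And>z. 0 < Im z \<Longrightarrow> norm (G (- 1 / z)) = norm z powr k * norm (G z)"
    and per: "\<And>z. 0 < Im z \<Longrightarrow> norm (G (z + 1)) = norm (G z)"
    and decay: "\<And>e. 0 < e \<Longrightarrow> \<exists>Y. \<forall>z. Y \<le> Im z \<longrightarrow> norm (G z) < e"
    and z: "0 < Im z"
  shows "G z = 0"
proof (rule ccontr)
  assume nz: "G z \<noteq> 0"
  define M where "M = (\<lambda>z. Im z powr (k / 2) * norm (G z))"
  have Minv: "M (- 1 / z) = M z" if "0 < Im z" for z
  proof -
    have z0: "z \<noteq> 0" using that by auto
    have "Im (- 1 / z) = Im z / (norm z)\<^sup>2" by (simp add: Im_divide cmod_power2)
    moreover have "(norm z)\<^sup>2 powr (k / 2) = norm z powr k"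
      using z0 by (simp add: powr_powr flip: powr_numeral)
    moreover have "norm (G (- (1 / z))) = norm z powr k * norm (G z)" using inv[OF that] by simp
    ultimately show ?thesis using that z0 by (simp add: M_def powr_divide)
  qed
  have Mper: "M (z + 1) = M z" if "0 < Im z" for z using that by (simp add: M_def per)
  note red = translate_inversion_Im_ge[of M, OF Minv Mper]
  define e where "e = M z"
  have e: "0 < e" using nz z by (simp add: e_def M_def)
  obtain Y where Y: "\<And>z. Y \<le> Im z \<Longrightarrow> norm (G z) < e" using decay[OF e] by blast
  \<comment> \<open>Heights at least 1 make \<open>Im w powr (k / 2)\<close> at most 1, so
    \<open>M < e\<close> above \<open>Y'\<close>; every point with \<open>M \<ge> e\<close>
    therefore has an equivalent one in the compact box \<open>K\<close>.\<close>
  define Y' where "Y' = max Y 1"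
  have high: "M w < e" if "Y' \<le> Im w" for w
  proof -
    have "Im w powr (k / 2) \<le> 1 powr (k / 2)" using that k by (intro powr_mono2') (auto simp: Y'_def)
    then have "M w \<le> 1 * norm (G w)" unfolding M_def by (intro mult_right_mono) auto
    then show ?thesis using Y[of w] that by (simp add: Y'_def)
  qed
  define K where "K = cbox (Complex (- 1 / 2) (1 / 2)) (Complex (1 / 2) Y')"
  have K: "w \<in> K \<longleftrightarrow> \<bar>Re w\<bar> \<le> 1 / 2 \<and> 1 / 2 \<le> Im w \<and> Im w \<le> Y'" for w
    by (auto simp: K_def in_cbox_complex_iff)
  have inK: "\<exists>w\<in>K. M w = M z" if "0 < Im z" "e \<le> M z" for z
    using red[OF _ _ that(1)] high that(2) K by (metis linorder_le_cases not_less)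
  have contM: "continuous_on K M"
    unfolding M_def using K
    by (intro continuous_intros holomorphic_on_imp_continuous_on holomorphic_on_subset[OF hol]) force+
  obtain w1 where "w1 \<in> K" "M w1 = e" using inK[OF z] by (auto simp: e_def)
  moreover obtain z0 where z0: "z0 \<in> K" "\<And>w. w \<in> K \<Longrightarrow> M w \<le> M z0"
    using continuous_attains_sup[OF _ _ contM] \<open>w1 \<in> K\<close> by (metis K_def compact_cbox empty_iff)
  ultimately have e_le: "e \<le> M z0" by auto
  have max: "M z \<le> M z0" if "0 < Im z" for z
    using inK[OF that] z0(2) e_le by (metis linorder_le_cases order_trans)
  define y0 where "y0 = Im z0"
  have y0: "0 < y0" using z0 K by (force simp: y0_def)
  \<comment> \<open>The constant \<open>k / (2 * y0)\<close> is the slope of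
    \<open>k / 2 * ln y\<close> at \<open>y0\<close>, so \<open>ln (norm (u z))\<close> is the
    tangent line there, shifted to vanish at \<open>y0\<close>. As \<open>k \<le> 0\<close>, the
    tangent lies below the curve.\<close>
  define u where "u = (\<lambda>z. exp (- \<i> * of_real (k / (2 * y0)) * (z - z0)))"
  have norm_u: "norm (u z) = exp (k / 2 * ((Im z - y0) / y0))" for z
    using y0 by (simp add: u_def y0_def field_simps)
  have "(\<lambda>z. G z * u z) constant_on {z. 0 < Im z}"
  proof (rule maximum_modulus_principle[where U = "{z. 0 < Im z}" and \<xi> = z0])
    show "(\<lambda>z. G z * u z) holomorphic_on {z. 0 < Im z}"
      unfolding u_def by (intro holomorphic_intros hol)
    show "connected {z. 0 < Im z}" by (intro convex_connected convex_halfspace_Im_gt)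
    fix z assume "z \<in> {z. 0 < Im z}"
    then have z: "0 < Im z" by simp
    have "ln (Im z / y0) \<le> Im z / y0 - 1" using z y0 by (intro ln_le_minus_one) auto
    then have "k / 2 * (Im z / y0 - 1) \<le> k / 2 * ln (Im z / y0)" using k by (intro mult_left_mono_neg) auto
    then have "exp (k / 2 * ((Im z - y0) / y0)) \<le> (Im z / y0) powr (k / 2)"
      using z y0 by (simp add: powr_def diff_divide_distrib)
    then have "norm (u z) \<le> Im z powr (k / 2) / y0 powr (k / 2)"
      using z y0 by (simp add: norm_u powr_divide)
    then have "norm (G z * u z) \<le> norm (G z) * (Im z powr (k / 2) / y0 powr (k / 2))"
      unfolding norm_mult by (intro mult_left_mono) auto
    also have "\<dots> = M z / y0 powr (k / 2)" by (simp add: M_def)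
    also have "\<dots> \<le> M z0 / y0 powr (k / 2)" using max[OF z] y0 by (intro divide_right_mono) auto
    also have "\<dots> = norm (G z0 * u z0)" using y0 by (simp add: M_def norm_mult norm_u flip: y0_def)
    finally show "norm (G z * u z) \<le> norm (G z0 * u z0)" .
  qed (use y0 in \<open>auto simp: open_halfspace_Im_gt y0_def\<close>)
  then have const: "G z * u z = G z0" if "0 < Im z" for z
    using that y0 unfolding constant_on_def by (metis (no_types, lifting) mem_Collect_eq y0_def u_def
        cancel_comm_monoid_add_class.diff_cancel exp_zero mult_zero_right mult.right_neutral)
  have "0 < norm (G z0)" using e e_le y0 by (auto simp: M_def y0_def zero_less_mult_iff)
  then obtain Y2 where Y2: "\<And>z. Y2 \<le> Im z \<Longrightarrow> norm (G z) < norm (G z0)" using decay by blast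
  \<comment> \<open>Above height \<open>y0\<close> the modulus of \<open>u\<close> is at most 1, so
    a constant nonzero \<open>G * u\<close> contradicts the decay of \<open>G\<close>.\<close>
  define z2 where "z2 = Complex 0 (max Y2 y0)"
  have "k * (max Y2 y0 - y0) \<le> 0" using k by (intro mult_nonpos_nonneg) auto
  then have "norm (u z2) \<le> 1"
    using y0 by (simp add: norm_u z2_def divide_nonpos_pos)
  then have "norm (G z2 * u z2) \<le> norm (G z2) * 1" unfolding norm_mult by (intro mult_left_mono) auto
  moreover have "G z2 * u z2 = G z0" using const[of z2] y0 by (simp add: z2_def)
  moreover have "norm (G z2) < norm (G z0)" by (rule Y2) (simp add: z2_def)
  ultimately show False by simp
qed

section \<open>Principal logarithm and powers of \<open>q\<close> under inversion and
  reflection\<close>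

lemma Ln_minus_one_over:
  assumes "0 < Im z"
  shows "Ln (- 1 / z) = \<i> * of_real pi - Ln z"
proof (rule Ln_unique)
  have "z \<noteq> 0" using assms by auto
  then show "exp (\<i> * of_real pi - Ln z) = - 1 / z" by (simp add: exp_diff)
  show "- pi < Im (\<i> * of_real pi - Ln z)" "Im (\<i> * of_real pi - Ln z) \<le> pi"
    using Im_Ln_pos_lt_imp[OF assms] by auto
qed

lemma Ln_minus_cnj:
  assumes "0 < Im z"
  shows "Ln (- cnj z) = cnj (Ln z) + \<i> * of_real pi"
proof (rule Ln_unique)
  have "z \<noteq> 0" using assms by auto
  then have "exp (cnj (Ln z)) = cnj z" using exp_cnj[of "Ln z"] by simp
  then show "exp (cnj (Ln z) + \<i> * of_real pi) = - cnj z" by (simp add: exp_add)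
  show "- pi < Im (cnj (Ln z) + \<i> * of_real pi)" "Im (cnj (Ln z) + \<i> * of_real pi) \<le> pi"
    using Im_Ln_pos_lt_imp[OF assms] by auto
qed

lemma q_pow_cis: "q_pow r z = of_real (exp (- 2 * pi * r * Im z)) * cis (2 * pi * r * Re z)"
  by (rule complex_eqI) (simp_all add: q_pow_def Re_exp Im_exp algebra_simps)

lemma norm_q_pow: "norm (q_pow r z) = exp (- 2 * pi * r * Im z)"
  by (simp add: q_pow_cis norm_mult)

lemma cnj_q_pow_minus_cnj: "cnj (q_pow r (- cnj z)) = q_pow r z"
  by (rule complex_eqI) (simp_all add: q_pow_cis)

lemma q_pow_DERIV: "(q_pow r has_field_derivative 2 * of_real pi * \<i> * of_real r * q_pow r z) (at z)"
  unfolding q_pow_def by (auto intro!: derivative_eq_intros)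

subsection \<open>Series in \<open>q\<close>\<close>

text \<open>Says that \<open>\<Sum>j. c j * x ^ j\<close> has radius of convergence at least 1,
  which is what convergence of a \<open>q\<close>-series on the whole half plane amounts to. The
  condition is indifferent to polynomial factors and to shifts of the exponents.\<close>

definition subexponential :: "(nat \<Rightarrow> complex) \<Rightarrow> bool" where
  "subexponential c \<longleftrightarrow> (\<forall>\<delta>>0. summable (\<lambda>j. norm (c j) * exp (- \<delta> * real j)))"

text \<open>The linear factor is the one produced by termwise differentiation. Of the decay rate
  \<open>24 * \<delta>\<close> per index, one \<open>\<delta>\<close> absorbs it and
  \<open>23 * \<delta>\<close> is left for summability.\<close>

lemma subexponential_summable:
  assumes c: "subexponential c" and "0 \<le> B" "0 < \<delta>" "0 \<le> s"
  shows "summable (\<lambda>j. norm (c j) * (1 + B * (24 * real j + s)) * exp (- \<delta> * (24 * real j + s)))"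
proof -
  define D where "D = 1 + B * (24 + s)"
  define E where "E = max 1 (1 / \<delta>)"
  have "summable (\<lambda>j. D * E * (norm (c j) * exp (- (23 * \<delta>) * real j)))"
    using c assms unfolding subexponential_def by (intro summable_mult) auto
  then show ?thesis
  proof (rule summable_comparison_test'[where N = 0])
    fix j :: nat
    have "1 + B * (24 * real j + s) \<le> D * (1 + real j)"
      using assms by (simp add: D_def algebra_simps)
    also have "1 + real j \<le> E * (1 + \<delta> * real j)"
    proof -
      have "1 \<le> E" "1 \<le> E * \<delta>" using assms by (auto simp: E_def field_simps max_def)
      then have "1 + 1 * real j \<le> E + (E * \<delta>) * real j" by (intro add_mono mult_right_mono) auto
      then show ?thesis by (simp add: algebra_simps)
    qed
    also have "1 + \<delta> * real j \<le> exp (\<delta> * real j)" by (rule exp_ge_add_one_self)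
    finally have "1 + B * (24 * real j + s) \<le> D * (E * exp (\<delta> * real j))"
      using assms by (simp add: D_def E_def mult_left_mono)
    moreover have "exp (- \<delta> * (24 * real j + s)) \<le> exp (- \<delta> * (24 * real j))"
      using assms by simp
    ultimately have "(1 + B * (24 * real j + s)) * exp (- \<delta> * (24 * real j + s))
        \<le> (D * (E * exp (\<delta> * real j))) * exp (- \<delta> * (24 * real j))"
      using assms by (intro mult_mono) (auto simp: D_def E_def)
    also have "\<dots> = D * E * exp (- (23 * \<delta>) * real j)"
      by (simp add: algebra_simps flip: exp_add)
    finally have "norm (c j) * ((1 + B * (24 * real j + s)) * exp (- \<delta> * (24 * real j + s)))
        \<le> norm (c j) * (D * E * exp (- (23 * \<delta>) * real j))" by (rule mult_left_mono) simp
    then show "norm (norm (c j) * (1 + B * (24 * real j + s)) * exp (- \<delta> * (24 * real j + s)))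
        \<le> D * E * (norm (c j) * exp (- (23 * \<delta>) * real j))"
      using assms by (simp add: mult_ac abs_of_nonneg)
  qed
qed

text \<open>With \<open>x = pi * n * y / 6\<close>, the weight of a coefficient is at least
  \<open>(x + 1) powr (- 5 / 2) * exp (- (x + 1)) * exp (x / 2)\<close>, hence at least a constant
  times \<open>exp (- 3 / 2 * x)\<close>; as \<open>y\<close> is arbitrary, this decay is as slow as
  desired.\<close>

lemma subexponentialI_upper_Gamma:
  assumes sum: "\<And>y. 0 < y \<Longrightarrow>
    summable (\<lambda>j. norm (c j) * upper_Gamma (- 3 / 2) (pi * (24 * real j + s) * y / 6)
      * exp (pi * (24 * real j + s) * y / 12))"
    and s: "0 < s"
  shows "subexponential c"
  unfolding subexponential_def
proof (intro allI impI)
  fix \<delta> :: real assume \<delta>: "0 < \<delta>"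
  \<comment> \<open>Chosen so that \<open>3 / 2 * x = \<delta> * j + 3 * e * s\<close> for
    \<open>x = 2 * e * (24 * j + s)\<close>; 72 is \<open>3 * 24\<close>. The 27 in \<open>C\<close>
    comes from cubing \<open>x + 1 \<le> 3 * exp (x / 3)\<close>.\<close>
  define e where "e = \<delta> / 72"
  define y where "y = 12 * e / pi"
  have e: "0 < e" and y: "0 < y" using \<delta> by (auto simp: e_def y_def)
  define C where "C = 27 * exp (1 + 3 * e * s)"
  have "summable (\<lambda>j. C * (norm (c j) * upper_Gamma (- 3 / 2) (pi * (24 * real j + s) * y / 6)
      * exp (pi * (24 * real j + s) * y / 12)))"
    by (intro summable_mult sum y)
  then show "summable (\<lambda>j. norm (c j) * exp (- \<delta> * real j))"
  proof (rule summable_comparison_test'[where N = 0])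
    fix j :: nat
    define x where "x = 2 * e * (24 * real j + s)"
    have x: "0 < x" using e s by (simp add: x_def add_nonneg_pos)
    have X: "pi * (24 * real j + s) * y / 6 = x" "pi * (24 * real j + s) * y / 12 = x / 2"
      by (simp_all add: x_def y_def)
    have "1 + x / 3 \<le> exp (x / 3)" by (rule exp_ge_add_one_self)
    then have "x + 1 \<le> 3 * exp (x / 3)" using x by linarith
    then have "(x + 1) ^ 3 \<le> (3 * exp (x / 3)) ^ 3" using x by (intro power_mono) auto
    also have "\<dots> = 27 * exp x" by (simp add: power_mult_distrib flip: exp_of_nat_mult)
    finally have "(x + 1) ^ 3 \<le> 27 * exp x" .
    moreover have "(x + 1) powr (5 / 2) \<le> (x + 1) powr 3" using x by (intro powr_mono) auto
    ultimately have p: "(x + 1) powr (5 / 2) \<le> 27 * exp x" using x by (simp add: powr_numeral)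
    have "exp (- \<delta> * real j) = exp (3 * e * s) * exp (- 3 / 2 * x)"
      by (simp add: x_def e_def algebra_simps flip: exp_add)
    also have "\<dots> = C * ((27 * exp x) powr (-1) * exp (- (x + 1)) * exp (x / 2))"
      using exp_gt_zero[of x] by (simp add: C_def powr_minus field_simps flip: exp_add)
    also have "\<dots> \<le> C * ((x + 1) powr (- 3 / 2 - 1) * exp (- (x + 1)) * exp (x / 2))"
    proof -
      have "(27 * exp x) powr (-1) \<le> ((x + 1) powr (5 / 2)) powr (-1)"
        using p x by (intro powr_mono2') auto
      also have "\<dots> = (x + 1) powr (- 3 / 2 - 1)" by (simp add: powr_powr powr_minus_divide)
      finally show ?thesis by (intro mult_left_mono mult_right_mono) (auto simp: C_def)
    qed
    also have "\<dots> \<le> C * (upper_Gamma (- 3 / 2) x * exp (x / 2))"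
      using x by (intro mult_left_mono mult_right_mono upper_Gamma_lower_bound) (auto simp: C_def)
    finally have "norm (c j) * exp (- \<delta> * real j)
        \<le> norm (c j) * (C * (upper_Gamma (- 3 / 2) x * exp (x / 2)))" by (rule mult_left_mono) simp
    then show "norm (norm (c j) * exp (- \<delta> * real j))
        \<le> C * (norm (c j) * upper_Gamma (- 3 / 2) (pi * (24 * real j + s) * y / 6)
      * exp (pi * (24 * real j + s) * y / 12))"
      unfolding X by (simp add: mult_ac)
  qed
qed

text \<open>Unordered summability of complex families is absolute, so the sum may be enumerated by
  \<open>j\<close>. The range \<open>0 < r \<le> 24\<close> ensures that the positive members of the
  class are exactly those with \<open>j \<ge> 0\<close>.\<close>

lemma residue_class_expansion:
  fixes f :: "int \<Rightarrow> complex"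
  assumes f: "f summable_on {n. 0 < n \<and> [n = c] (mod 24)}" and r: "0 < r" "r \<le> 24" "[c = r] (mod 24)"
  shows "summable (\<lambda>j. norm (f (24 * int j + r)))"
    and "(\<Sum>\<^sub>\<infinity>n\<in>{n. 0 < n \<and> [n = c] (mod 24)}. f n) = (\<Sum>j. f (24 * int j + r))"
proof -
  define g where "g = (\<lambda>j. 24 * int j + r)"
  have inj: "inj g" by (auto simp: g_def inj_on_def)
  have "{n. 0 < n \<and> [n = c] (mod 24)} = {n. 0 < n \<and> [n = r] (mod 24)}"
    using r(3) by (meson cong_sym cong_trans)
  also have "\<dots> = range g"
  proof (intro equalityI subsetI)
    fix n assume "n \<in> {n. 0 < n \<and> [n = r] (mod 24)}"
    then have n: "0 < n" "24 dvd n - r" by (auto simp: cong_iff_dvd_diff)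
    then obtain k where k: "n - r = 24 * k" by (elim dvdE)
    with n r have "0 \<le> k" by linarith
    then have "n = g (nat k)" using k by (simp add: g_def)
    then show "n \<in> range g" by blast
  next
    fix n assume "n \<in> range g"
    then show "n \<in> {n. 0 < n \<and> [n = r] (mod 24)}" using r by (auto simp: g_def cong_iff_dvd_diff)
  qed
  finally have S: "{n. 0 < n \<and> [n = c] (mod 24)} = range g" .
  have s: "(f \<circ> g) summable_on UNIV" using f unfolding S by (simp add: summable_on_reindex[OF inj])
  then have "(\<lambda>j. norm ((f \<circ> g) j)) summable_on UNIV"
    by (simp add: summable_on_iff_abs_summable_on_complex)
  then show "summable (\<lambda>j. norm (f (24 * int j + r)))"
    by (simp add: summable_on_UNIV_nonneg_real_iff g_def)
  have "infsum f (range g) = infsum (f \<circ> g) UNIV" by (rule infsum_reindex[OF inj])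
  also have "\<dots> = (\<Sum>j. (f \<circ> g) j)"
    by (rule sums_unique[OF has_sum_imp_sums[OF has_sum_infsum[OF s]]])
  finally show "(\<Sum>\<^sub>\<infinity>n\<in>{n. 0 < n \<and> [n = c] (mod 24)}. f n) = (\<Sum>j. f (24 * int j + r))"
    by (simp add: S g_def)
qed


lemma subexponential_mult_bounded:
  assumes "subexponential c" "\<And>j. norm (d j) \<le> B * norm (c j)"
  shows "subexponential d"
  unfolding subexponential_def
proof (intro allI impI)
  fix \<delta> :: real assume "0 < \<delta>"
  then have "summable (\<lambda>j. B * (norm (c j) * exp (- \<delta> * real j)))"
    using assms(1) by (intro summable_mult) (auto simp: subexponential_def)
  then show "summable (\<lambda>j. norm (d j) * exp (- \<delta> * real j))"
  proof (rule summable_comparison_test'[where N = 0])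
    fix j
    show "norm (norm (d j) * exp (- \<delta> * real j)) \<le> B * (norm (c j) * exp (- \<delta> * real j))"
      using mult_right_mono[OF assms(2)[of j], of "exp (- \<delta> * real j)"] by (simp add: mult_ac)
  qed
qed

definition q_series :: "real \<Rightarrow> (nat \<Rightarrow> complex) \<Rightarrow> complex \<Rightarrow> complex" where
  "q_series s c z = (\<Sum>j. c j * q_pow ((24 * real j + s) / 24) z)"

lemma norm_q_series_term:
  "norm (c * q_pow ((24 * real j + s) / 24) z) = norm c * exp (- (pi * Im z / 12) * (24 * real j + s))"
proof -
  have "- 2 * pi * ((24 * real j + s) / 24) * Im z = - (pi * Im z / 12) * (24 * real j + s)"
    by (simp add: field_simps)
  then show ?thesis by (simp only: norm_mult norm_q_pow)
qed

lemma q_series_summable_norm: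
  assumes "subexponential c" "0 \<le> s" "0 < y"
  shows "summable (\<lambda>j. norm (c j) * exp (- (pi * y / 12) * (24 * real j + s)))"
  using subexponential_summable[OF assms(1), of 0 "pi * y / 12" s] assms by simp

lemma q_series_summable:
  assumes "subexponential c" "0 \<le> s" "0 < Im z"
  shows "summable (\<lambda>j. c j * q_pow ((24 * real j + s) / 24) z)"
  by (rule summable_norm_cancel)
    (use q_series_summable_norm[OF assms] in \<open>simp only: norm_q_series_term\<close>)

text \<open>Termwise differentiation with vanishing antilinear part; the majorant lives on
  \<open>Y < Im z\<close> with \<open>Y\<close> half the height of the point.\<close>

lemma q_series_holomorphic:
  assumes c: "subexponential c" and s: "0 \<le> s"
  shows "q_series s c holomorphic_on {z. 0 < Im z}"
  unfolding holomorphic_on_def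
proof
  fix z assume "z \<in> {z. 0 < Im z}"
  define Y where "Y = Im z / 2"
  have Y: "0 < Y" "Y < Im z" using \<open>z \<in> _\<close> by (auto simp: Y_def)
  define l where "l = (\<lambda>j::nat. 24 * real j + s)"
  have l: "0 \<le> l j" for j using s by (simp add: l_def)
  let ?a = "\<lambda>j z. 2 * of_real pi * \<i> * of_real (l j / 24) * (c j * q_pow (l j / 24) z)"
  let ?M = "\<lambda>j. norm (c j) * (1 + (pi / 12) * l j) * exp (- (pi * Y / 12) * l j)"
  have nb: "norm (c j * q_pow (l j / 24) w) \<le> norm (c j) * exp (- (pi * Y / 12) * l j)" if "Y < Im w" for w j
  proof -
    have "pi * (Y * l j) \<le> pi * (Im w * l j)"
      using that l[of j] by (intro mult_left_mono mult_right_mono) auto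
    then show ?thesis unfolding norm_mult norm_q_pow by (intro mult_left_mono) (auto simp: algebra_simps)
  qed
  have "((\<lambda>z. \<Sum>j. c j * q_pow (l j / 24) z) has_derivative
      (\<lambda>v. (\<Sum>j. ?a j z) * v + (\<Sum>j. 0) * cnj v)) (at z)"
  proof (rule suminf_has_derivative_cnj[where S = "{z. Y < Im z}" and M = ?M])
    fix j w assume w: "w \<in> {z. Y < Im z}"
    show "((\<lambda>z. c j * q_pow (l j / 24) z) has_derivative (\<lambda>v. ?a j w * v + 0 * cnj v)) (at w)"
      using DERIV_cmult[OF q_pow_DERIV[of "l j / 24" w], of "c j"]
      unfolding has_field_derivative_def
      by (rule has_derivative_eq_rhs) (simp add: fun_eq_iff)
    have le: "1 * (norm (c j) * exp (- (pi * Y / 12) * l j)) \<le> (1 + pi / 12 * l j) * (norm (c j) * exp (- (pi * Y / 12) * l j))"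
      using l[of j] by (intro mult_right_mono) auto
    then show "norm (c j * q_pow (l j / 24) w) \<le> ?M j"
      using nb[of w j] w by (simp add: mult_ac)
    have "norm (?a j w) = (pi / 12 * l j) * norm (c j * q_pow (l j / 24) w)"
      using l[of j] by (simp add: norm_mult)
    also have "\<dots> \<le> (1 + pi / 12 * l j) * (norm (c j) * exp (- (pi * Y / 12) * l j))"
      using nb[of w j] w l[of j] by (intro mult_mono) auto
    finally show "norm (?a j w) \<le> ?M j" by (simp add: mult_ac)
    show "norm (0::complex) \<le> ?M j" using l[of j] by (auto intro!: mult_nonneg_nonneg)
  next
    show "summable ?M" unfolding l_def
      using subexponential_summable[OF c, of "pi / 12" "pi * Y / 12" s] Y s by simp
  qed (use Y in \<open>auto simp: open_halfspace_Im_gt convex_halfspace_Im_gt\<close>)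
  then have "(q_series s c has_field_derivative (\<Sum>j. ?a j z)) (at z)"
    unfolding has_field_derivative_def q_series_def[abs_def] l_def by simp
  then show "q_series s c field_differentiable at z within {z. 0 < Im z}"
    by (meson field_differentiable_def field_differentiable_at_within)
qed

text \<open>Relative to height 1, every term shrinks at least by the factor belonging to the
  smallest exponent \<open>s / 24\<close>, which is positive.\<close>

lemma q_series_decay:
  assumes c: "subexponential c" and s: "0 < s" and e: "0 < e"
  shows "\<exists>Y. \<forall>z. Y \<le> Im z \<longrightarrow> norm (q_series s c z) < e"
proof -
  define C where "C = (\<Sum>j. norm (c j) * exp (- (pi * 1 / 12) * (24 * real j + s)))"
  have sm: "summable (\<lambda>j. norm (c j) * exp (- (pi * y / 12) * (24 * real j + s)))" if "0 < y" for y
    by (rule q_series_summable_norm[OF c less_imp_le[OF s] that])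
  have bound: "norm (q_series s c z) \<le> exp (- (pi * s / 12) * (Im z - 1)) * C" if "1 \<le> Im z" for z
  proof -
    have "norm (q_series s c z) \<le> (\<Sum>j. norm (c j) * exp (- (pi * Im z / 12) * (24 * real j + s)))"
      unfolding q_series_def
      using summable_norm[of "\<lambda>j. c j * q_pow ((24 * real j + s) / 24) z"] sm[of "Im z"] that
      by (simp only: norm_q_series_term)
    also have "\<dots> \<le> (\<Sum>j. exp (- (pi * s / 12) * (Im z - 1)) * (norm (c j) * exp (- (pi * 1 / 12) * (24 * real j + s))))"
    proof (rule suminf_le)
      fix j
      have "0 \<le> pi * ((Im z - 1) * real j)" using that by (intro mult_nonneg_nonneg) auto
      moreover have "- (pi * Im z / 12) * (24 * real j + s) = - (pi * s / 12) * (Im z - 1)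
          + - (pi * 1 / 12) * (24 * real j + s) - 2 * (pi * ((Im z - 1) * real j))"
        by (simp add: field_simps)
      ultimately have "- (pi * Im z / 12) * (24 * real j + s)
          \<le> - (pi * s / 12) * (Im z - 1) + - (pi * 1 / 12) * (24 * real j + s)" by linarith
      then have "exp (- (pi * Im z / 12) * (24 * real j + s))
          \<le> exp (- (pi * s / 12) * (Im z - 1)) * exp (- (pi * 1 / 12) * (24 * real j + s))"
        by (simp only: exp_add[symmetric] exp_le_cancel_iff)
      then show "norm (c j) * exp (- (pi * Im z / 12) * (24 * real j + s))
          \<le> exp (- (pi * s / 12) * (Im z - 1)) * (norm (c j) * exp (- (pi * 1 / 12) * (24 * real j + s)))"
        using mult_left_mono[OF _ norm_ge_zero[of "c j"]] by (metis mult.left_commute)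
    next
      show "summable (\<lambda>j. norm (c j) * exp (- (pi * Im z / 12) * (24 * real j + s)))"
        using that by (intro sm) simp
      show "summable (\<lambda>j. exp (- (pi * s / 12) * (Im z - 1)) * (norm (c j) * exp (- (pi * 1 / 12) * (24 * real j + s))))"
        by (intro summable_mult sm) simp
    qed
    also have "\<dots> = exp (- (pi * s / 12) * (Im z - 1)) * C"
      unfolding C_def by (rule suminf_mult) (rule sm, simp)
    finally show ?thesis .
  qed
  have "((\<lambda>y. exp (- (pi * s / 12) * (y - 1)) * C) \<longlongrightarrow> 0) at_top" using s by real_asymp
  then have "\<forall>\<^sub>F y in at_top. exp (- (pi * s / 12) * (y - 1)) * C < e" by (rule order_tendstoD(2)) fact
  then obtain Y where Y: "\<And>y. Y \<le> y \<Longrightarrow> exp (- (pi * s / 12) * (y - 1)) * C < e"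
    by (auto simp: eventually_at_top_linorder)
  show ?thesis
    by (intro exI[of _ "max Y 1"]) (use bound Y in \<open>force intro: le_less_trans\<close>)
qed

text \<open>Since \<open>Im v = (v - cnj v) / (2 * \<i>)\<close>, a derivative \<open>D\<close> in
  the height enters the two Wirtinger derivatives as \<open>- \<i> / 2 * D\<close> and
  \<open>\<i> / 2 * D\<close>.\<close>

lemma fun_Im_q_pow_has_derivative:
  assumes "(F has_vector_derivative D) (at (Im z))"
  shows "((\<lambda>z. F (Im z) * q_pow s z) has_derivative
    (\<lambda>v. (2 * of_real pi * \<i> * of_real s * (F (Im z) * q_pow s z) - \<i> / 2 * D * q_pow s z) * v
       + (\<i> / 2 * D * q_pow s z) * cnj v)) (at z)"
proof -
  have "((\<lambda>z. F (Im z)) has_derivative (\<lambda>v. Im v *\<^sub>R D)) (at z)"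
    using has_derivative_compose[OF has_derivative_Im[OF has_derivative_ident]
        assms[unfolded has_vector_derivative_def]] by simp
  then have "((\<lambda>z. F (Im z) * q_pow s z) has_derivative
      (\<lambda>v. F (Im z) * (2 * of_real pi * \<i> * of_real s * q_pow s z * v) + Im v *\<^sub>R D * q_pow s z)) (at z)"
    by (intro has_derivative_mult q_pow_DERIV[unfolded has_field_derivative_def])
  moreover have "Im v *\<^sub>R D = \<i> / 2 * D * cnj v - \<i> / 2 * D * v" for v
    by (simp add: complex_eq_iff field_simps)
  ultimately show ?thesis by (simp add: algebra_simps)
qed

subsection \<open>The nonholomorphic terms\<close>

text \<open>The factor common to the \<open>cnj z\<close>-derivatives of all terms of the expansion:
  \<open>y\<close> to the power minus the weight, times a constant from the arguments
  \<open>pi * r * y / 6\<close>. What remains after removing it is the conjugate of a holomorphic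
  function.\<close>

definition shadow_factor :: "real \<Rightarrow> complex" where
  "shadow_factor y = \<i> / 2 * of_real ((pi / 6) powr (- 3 / 2) * y powr (- 5 / 2))"

text \<open>The integrand of the incomplete Gamma function contributes the exponent
  \<open>- 5 / 2\<close>, the chain rule the factor \<open>pi * r / 6\<close>. The resulting
  \<open>r powr (- 3 / 2)\<close> is the origin of the powers 3/2 in the duality.\<close>

lemma powr_product_identity:
  assumes "0 < r" "0 < y"
  shows "(pi * r * y / 6) powr (- 5 / 2) * (pi * r / 6)
    = (pi / 6) powr (- 3 / 2) * y powr (- 5 / 2) * r powr (- 3 / 2)"
proof -
  have gen: "(p * r * y) powr (- 5 / 2) * (p * r) = p powr (- 3 / 2) * y powr (- 5 / 2) * r powr (- 3 / 2)"
    if "0 < p" for p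
  proof -
    have *: "a powr (- 5 / 2) * a = a powr (- 3 / 2)" if "0 < a" for a :: real
      using that powr_add[of a "- 5 / 2" 1] by simp
    have "(p * r * y) powr (- 5 / 2) * (p * r)
        = (p powr (- 5 / 2) * p) * y powr (- 5 / 2) * (r powr (- 5 / 2) * r)"
      using assms that by (simp add: powr_mult)
    then show ?thesis by (simp only: *[OF that] *[OF assms(1)])
  qed
  have "pi * r * y / 6 = pi / 6 * r * y" "pi * r / 6 = pi / 6 * r" by simp_all
  then show ?thesis using gen[of "pi / 6"] by (metis pi_gt_zero zero_less_divide_iff zero_less_numeral)
qed

text \<open>The exponential left by differentiating the incomplete Gamma function turns the negative
  power of \<open>q\<close> into an antiholomorphic function.\<close>

lemma exp_q_pow_minus: "of_real (exp (- (pi * r * Im z / 6))) * q_pow (- r / 24) z = cnj (q_pow (r / 24) z)"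
proof -
  have "exp (- (pi * r * Im z / 6)) * exp (- 2 * pi * (- r / 24) * Im z) = exp (- 2 * pi * (r / 24) * Im z)"
    by (simp flip: exp_add)
  then have "complex_of_real (exp (- (pi * r * Im z / 6))) * of_real (exp (- 2 * pi * (- r / 24) * Im z))
    = of_real (exp (- 2 * pi * (r / 24) * Im z))" by (metis of_real_mult)
  then show ?thesis by (simp add: q_pow_cis cis_cnj mult.assoc flip: mult.assoc[of "of_real _" "of_real _"])
qed

definition nonhol_term :: "real \<Rightarrow> complex \<Rightarrow> complex" where
  "nonhol_term r z = of_real (upper_Gamma (- 3 / 2) (pi * r * Im z / 6)) * q_pow (- r / 24) z"

definition sing_term :: "real \<Rightarrow> complex \<Rightarrow> complex" where
  "sing_term r z = \<i> * beta_fun (- r * Im z) * q_pow (r / 24) z"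

lemma nonhol_term_has_derivative:
  assumes r: "0 < r" and z: "0 < Im z"
  shows "(nonhol_term r has_derivative
    (\<lambda>v. (- (2 * of_real pi * \<i> * of_real (r / 24) * nonhol_term r z)
            + shadow_factor (Im z) * cnj (of_real (r powr (- 3 / 2)) * q_pow (r / 24) z)) * v
       + (- (shadow_factor (Im z) * cnj (of_real (r powr (- 3 / 2)) * q_pow (r / 24) z))) * cnj v)) (at z)"
proof -
  define X where "X = pi * r * Im z / 6"
  have X: "0 < X" using r z by (simp add: X_def)
  have "((\<lambda>y. upper_Gamma (- 3 / 2) (pi * r * y / 6)) has_real_derivative
      - (exp (- X) * X powr (- 5 / 2)) * (pi * r / 6)) (at (Im z))"
    by (rule DERIV_chain2[where f = "upper_Gamma (- 3 / 2)" and g = "\<lambda>y. pi * r * y / 6"])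
      (use upper_Gamma_DERIV[OF X, of "- 3 / 2"] in \<open>auto simp: X_def intro!: derivative_eq_intros\<close>)
  then have "((\<lambda>y. complex_of_real (upper_Gamma (- 3 / 2) (pi * r * y / 6))) has_vector_derivative
      of_real (- (exp (- X) * X powr (- 5 / 2)) * (pi * r / 6))) (at (Im z))"
    by (intro has_vector_derivative_of_real) (simp add: has_real_derivative_iff_has_vector_derivative)
  note der = fun_Im_q_pow_has_derivative[OF this, of "- r / 24"]
  have eq: "\<i> / 2 * of_real (- (exp (- X) * X powr (- 5 / 2)) * (pi * r / 6)) * q_pow (- r / 24) z
    = - (shadow_factor (Im z) * cnj (of_real (r powr (- 3 / 2)) * q_pow (r / 24) z))"
  proof -
    have "\<i> / 2 * of_real (- (exp (- X) * X powr (- 5 / 2)) * (pi * r / 6)) * q_pow (- r / 24) z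
      = - (\<i> / 2 * of_real (X powr (- 5 / 2) * (pi * r / 6)) * (of_real (exp (- X)) * q_pow (- r / 24) z))"
      by simp
    also have "\<dots> = - (\<i> / 2 * of_real ((pi / 6) powr (- 3 / 2) * Im z powr (- 5 / 2) * r powr (- 3 / 2)) * cnj (q_pow (r / 24) z))"
      using powr_product_identity[OF r z] exp_q_pow_minus[of r z] by (simp only: X_def)
    finally show ?thesis by (simp add: shadow_factor_def)
  qed
  have "2 * of_real pi * \<i> * of_real (- r / 24) * N - - E = - (2 * of_real pi * \<i> * of_real (r / 24) * N) + E"
    for N E by simp
  then show ?thesis
    unfolding nonhol_term_def[abs_def] using der[unfolded eq] by (simp only:)
qed

lemma sing_term_has_derivative:
  assumes r: "0 < r" and z: "0 < Im z"
  shows "(sing_term r has_derivative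
    (\<lambda>v. (2 * of_real pi * \<i> * of_real (r / 24) * sing_term r z
            - shadow_factor (Im z) * cnj (of_real (r powr (- 3 / 2)) * q_pow (- r / 24) z)) * v
       + shadow_factor (Im z) * cnj (of_real (r powr (- 3 / 2)) * q_pow (- r / 24) z) * cnj v)) (at z)"
proof -
  define X where "X = pi * r * Im z / 6"
  have X: "0 < X" using r z by (simp add: X_def)
  have "((\<lambda>x. inc_Gamma (- 3 / 2) (- x)) has_vector_derivative of_real (exp X * X powr (- 5 / 2)) * cis (pi * (- 3 / 2 - 1))) (at X)"
    using inc_Gamma_neg_has_vector_derivative[OF X, of "- 3 / 2"] by simp
  \<comment> \<open>This phase is cancelled by the factor \<open>\<i>\<close> in
    \<open>sing_term\<close>, so the principal part of the shadow gets a real coefficient.\<close>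
  moreover have "cis (pi * (- 3 / 2 - 1)) = - \<i>"
  proof -
    have "cis (pi * (- 3 / 2 - 1)) = cis (- (pi / 2) + - (2 * pi))" by (rule arg_cong[of _ _ cis]) simp
    also have "\<dots> = cis (- (pi / 2)) * cis (- (2 * pi))" by (simp only: cis_mult)
    finally show ?thesis by (simp add: complex_eq_iff)
  qed
  ultimately have "((\<lambda>x. inc_Gamma (- 3 / 2) (- x)) has_vector_derivative of_real (exp X * X powr (- 5 / 2)) * (- \<i>)) (at X)"
    by simp
  then have "((\<lambda>x. inc_Gamma (- 3 / 2) (- x)) \<circ> (\<lambda>y. pi * r * y / 6) has_vector_derivative
      (pi * r / 6) *\<^sub>R (of_real (exp X * X powr (- 5 / 2)) * (- \<i>))) (at (Im z))"
    by (intro vector_diff_chain_at) (auto intro!: derivative_eq_intros simp: X_def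
        simp flip: has_real_derivative_iff_has_vector_derivative)
  then have "((\<lambda>y. \<i> * (((\<lambda>x. inc_Gamma (- 3 / 2) (- x)) \<circ> (\<lambda>y. pi * r * y / 6)) y)) has_vector_derivative
      \<i> * ((pi * r / 6) *\<^sub>R (of_real (exp X * X powr (- 5 / 2)) * (- \<i>)))) (at (Im z))"
    by (rule has_vector_derivative_mult_right)
  then have "((\<lambda>y. \<i> * beta_fun (- r * y)) has_vector_derivative
      of_real (exp X * X powr (- 5 / 2) * (pi * r / 6))) (at (Im z))"
    by (simp add: beta_fun_def o_def scaleR_conv_of_real mult_ac)
  note der = fun_Im_q_pow_has_derivative[OF this, of "r / 24"]
  have eq: "\<i> / 2 * of_real (exp X * X powr (- 5 / 2) * (pi * r / 6)) * q_pow (r / 24) z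
    = shadow_factor (Im z) * cnj (of_real (r powr (- 3 / 2)) * q_pow (- r / 24) z)"
  proof -
    have "\<i> / 2 * of_real (exp X * X powr (- 5 / 2) * (pi * r / 6)) * q_pow (r / 24) z
      = \<i> / 2 * of_real (X powr (- 5 / 2) * (pi * r / 6)) * (of_real (exp X) * q_pow (r / 24) z)"
      by simp
    also have "\<dots> = \<i> / 2 * of_real ((pi / 6) powr (- 3 / 2) * Im z powr (- 5 / 2) * r powr (- 3 / 2)) * cnj (q_pow (- r / 24) z)"
      using powr_product_identity[OF r z] exp_q_pow_minus[of "- r" z] by (simp add: X_def)
    finally show ?thesis by (simp add: shadow_factor_def)
  qed
  show ?thesis
    unfolding sing_term_def[abs_def] using der[unfolded eq] .
qed

text \<open>The values at 1 and \<open>\<i>\<close> separate linear and antilinear parts. This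
  carries identities between forms over to their shadows.\<close>

lemma has_derivative_cnj_unique:
  assumes "(f has_derivative (\<lambda>v. a * v + b * cnj v)) (at z)"
    "(f has_derivative (\<lambda>v. a' * v + b' * cnj v)) (at z)"
  shows "b = b'"
proof -
  have eq: "a * v + b * cnj v = a' * v + b' * cnj v" for v
    using has_derivative_unique[OF assms] by (simp add: fun_eq_iff)
  have "a + b = a' + b'" using eq[of 1] by simp
  moreover have "\<i> * (a - b) = \<i> * (a' - b')" using eq[of \<i>] by (simp add: algebra_simps)
  then have "a - b = a' - b'" by simp
  ultimately have "(a + b) - (a - b) = (a' + b') - (a' - b')" by simp
  then show ?thesis by simp
qed

lemma q_series_periodic:
  assumes "subexponential c" "0 \<le> s" "0 < Im z"
  shows "q_series s c (z + 1) = cis (2 * pi * s / 24) * q_series s c z"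
proof -
  have "q_pow ((24 * real j + s) / 24) (z + 1) = cis (2 * pi * s / 24) * q_pow ((24 * real j + s) / 24) z" for j
  proof -
    have "2 * pi * ((24 * real j + s) / 24) * Re (z + 1)
        = 2 * pi * of_int (int j) + (2 * pi * s / 24 + 2 * pi * ((24 * real j + s) / 24) * Re z)"
      by (simp add: field_simps)
    moreover have "cis (2 * pi * of_int (int j)) = 1" by (rule cis_multiple_2pi) simp
    ultimately have "cis (2 * pi * ((24 * real j + s) / 24) * Re (z + 1))
        = cis (2 * pi * s / 24) * cis (2 * pi * ((24 * real j + s) / 24) * Re z)"
      by (simp only: cis_mult[symmetric] mult_1)
    then show ?thesis by (simp only: q_pow_cis) simp
  qed
  then have "q_series s c (z + 1)
      = (\<Sum>j. cis (2 * pi * s / 24) * (c j * q_pow ((24 * real j + s) / 24) z))"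
    unfolding q_series_def by (simp only: mult.left_commute)
  also have "\<dots> = cis (2 * pi * s / 24) * q_series s c z"
    unfolding q_series_def by (rule suminf_mult[OF q_series_summable[OF assms]])
  finally show ?thesis .
qed

lemma cnj_q_series_minus_cnj:
  assumes "subexponential c" "0 \<le> s" "0 < Im z"
  shows "cnj (q_series s c (- cnj z)) = q_series s (\<lambda>j. cnj (c j)) z"
proof -
  have "cnj (q_series s c (- cnj z)) = (\<Sum>j. cnj (c j * q_pow ((24 * real j + s) / 24) (- cnj z)))"
    unfolding q_series_def
    by (rule bounded_linear.suminf[OF bounded_linear_cnj q_series_summable]) (use assms in auto)
  then show ?thesis unfolding q_series_def by (simp only: complex_cnj_mult cnj_q_pow_minus_cnj)
qed

lemma subexponential_cnj: "subexponential c \<Longrightarrow> subexponential (\<lambda>j. cnj (c j))"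
  by (rule subexponential_mult_bounded[where B = 1]) auto

lemma continuous_on_suminf_half_planes:
  fixes f :: "nat \<Rightarrow> complex \<Rightarrow> complex"
  assumes f: "\<And>j. continuous_on {z. 0 < Im z} (f j)"
    and M: "\<And>Y. 0 < Y \<Longrightarrow> \<exists>M. summable M \<and> (\<forall>j z. Y < Im z \<longrightarrow> norm (f j z) \<le> M j)"
  shows "continuous_on {z. 0 < Im z} (\<lambda>z. \<Sum>j. f j z)"
proof (rule continuous_at_imp_continuous_on, rule ballI)
  fix z assume "z \<in> {z. 0 < Im z}"
  then have Y: "0 < Im z / 2" "z \<in> {w. Im z / 2 < Im w}" by auto
  obtain M where M: "summable M" "\<And>j w. Im z / 2 < Im w \<Longrightarrow> norm (f j w) \<le> M j"
    using assms(2)[OF Y(1)] by blast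
  have "continuous_on {w. Im z / 2 < Im w} (\<lambda>z. \<Sum>j. f j z)"
    by (rule continuous_on_suminf_bounded[OF continuous_on_subset[OF f] _ M(1)]) (use Y M in auto)
  then show "continuous (at z) (\<lambda>z. \<Sum>j. f j z)"
    using Y(2) continuous_on_eq_continuous_at[OF open_halfspace_Im_gt[of "Im z / 2"]] by blast
qed

definition shadow_term :: "real \<Rightarrow> complex \<Rightarrow> complex" where
  "shadow_term r z = shadow_factor (Im z) * cnj (of_real (r powr (- 3 / 2)) * q_pow (r / 24) z)"

lemma norm_nonhol_term:
  assumes "0 < r" "0 < y"
  shows "norm (nonhol_term r (Complex x y)) = upper_Gamma (- 3 / 2) (pi * r * y / 6) * exp (pi * r * y / 12)"
  using upper_Gamma_nonneg by (simp add: nonhol_term_def norm_mult norm_q_pow)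

text \<open>With \<open>X = pi * r * Im z / 6\<close>, the incomplete Gamma function decays like
  \<open>exp (- X)\<close> while the power of \<open>q\<close> grows only like
  \<open>exp (X / 2)\<close>. The condition \<open>1 \<le> r\<close> keeps \<open>X\<close> away
  from 0, where the negative powers blow up.\<close>

lemma nonhol_term_bound:
  assumes Y: "0 < Y"
  shows "\<exists>K. \<forall>r z. 1 \<le> r \<longrightarrow> Y < Im z \<longrightarrow>
    norm (nonhol_term r z) \<le> K * exp (- (pi * Y / 12) * r) \<and>
    norm (shadow_term r z) \<le> K * exp (- (pi * Y / 12) * r)"
proof -
  define K1 where "K1 = (pi * Y / 6) powr (- 5 / 2)"
  define K2 where "K2 = 1 / 2 * ((pi / 6) powr (- 3 / 2) * Y powr (- 5 / 2))"
  show ?thesis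
  proof (intro exI[of _ "K1 + K2"] allI impI conjI)
    fix r :: real and z :: complex assume r: "1 \<le> r" and z: "Y < Im z"
    define X where "X = pi * r * Im z / 6"
    have Yr: "Y * r \<le> Im z * r" using r z by (intro mult_right_mono) auto
    have "Y * 1 \<le> Im z * r" using r z Y by (intro mult_mono) auto
    then have X: "pi * Y / 6 \<le> X" "0 < X" using Y r z by (auto simp: X_def mult_ac)
    have e: "exp (- (X / 2)) \<le> exp (- (pi * Y / 12) * r)"
      using mult_left_mono[OF Yr, of pi] by (simp add: X_def mult_ac)
    have "norm (nonhol_term r z) = upper_Gamma (- 3 / 2) X * exp (X / 2)"
      using upper_Gamma_nonneg by (simp add: nonhol_term_def norm_mult norm_q_pow X_def)
    also have "\<dots> \<le> (X powr (- 3 / 2 - 1) * exp (- X)) * exp (X / 2)"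
      using X by (intro mult_right_mono upper_Gamma_upper_bound) auto
    also have "\<dots> = X powr (- 5 / 2) * exp (- (X / 2))"
      by (simp add: mult.assoc flip: exp_add)
    also have "\<dots> \<le> K1 * exp (- (pi * Y / 12) * r)"
      unfolding K1_def using X Y e by (intro mult_mono powr_mono2') auto
    also have "\<dots> \<le> (K1 + K2) * exp (- (pi * Y / 12) * r)"
      by (intro mult_right_mono) (auto simp: K2_def)
    finally show "norm (nonhol_term r z) \<le> (K1 + K2) * exp (- (pi * Y / 12) * r)" .
    have "norm (shadow_term r z) = 1 / 2 * ((pi / 6) powr (- 3 / 2) * Im z powr (- 5 / 2)) * (r powr (- 3 / 2) * exp (- (X / 2)))"
      by (simp add: shadow_term_def shadow_factor_def norm_mult norm_q_pow X_def)
    also have "\<dots> \<le> K2 * (1 powr (- 3 / 2) * exp (- (pi * Y / 12) * r))"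
      unfolding K2_def using r z Y e by (intro mult_mono powr_mono2') auto
    also have "\<dots> \<le> (K1 + K2) * exp (- (pi * Y / 12) * r)"
      by (simp add: K1_def)
    finally show "norm (shadow_term r z) \<le> (K1 + K2) * exp (- (pi * Y / 12) * r)" .
  qed
qed

lemma continuous_on_has_derivative:
  assumes "\<And>z. z \<in> S \<Longrightarrow> (f has_derivative f' z) (at z)"
  shows "continuous_on S f"
  by (intro continuous_at_imp_continuous_on ballI has_derivative_continuous[OF assms])

lemma continuous_on_shadow_factor: "continuous_on {z. 0 < Im z} (\<lambda>z. shadow_factor (Im z))"
  unfolding shadow_factor_def by (auto intro!: continuous_intros)

section \<open>Forms given by their expansions, and their shadows\<close>

text \<open>\<open>cp j\<close> and \<open>cm j\<close> are the coefficients at the indices \<open>24 * j + 1\<close> and \<open>24 * j + 23\<close>.\<close>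

locale h_series =
  fixes m :: int and cp cm :: "nat \<Rightarrow> complex"
  assumes m_pos: "0 < m" and cp: "subexponential cp" and cm: "subexponential cm"
begin

definition nonhol :: "complex \<Rightarrow> complex" where
  "nonhol z = (\<Sum>j. cm j * nonhol_term (24 * real j + 23) z)"

definition form :: "complex \<Rightarrow> complex" where
  "form z = q_series 1 cp z + sing_term (of_int m) z + nonhol z"

definition shadow_coeff :: "nat \<Rightarrow> complex" where
  "shadow_coeff j = cnj (cm j) * of_real ((24 * real j + 23) powr (- 3 / 2))"

text \<open>Up to a constant, the image of \<open>form\<close> under the operator
  \<open>\<xi>\<close> of weight 5/2, which takes \<open>y powr (5 / 2)\<close> times the conjugate
  of the \<open>cnj z\<close>-derivative.\<close>

definition shadow :: "complex \<Rightarrow> complex" where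
  "shadow z = of_real (of_int m powr (- 3 / 2)) * q_pow (- of_int m / 24) z - q_series 23 shadow_coeff z"

lemma shadow_coeff: "subexponential shadow_coeff"
proof (rule subexponential_mult_bounded[OF cm, where B = 1])
  fix j
  have "(24 * real j + 23) powr (- 3 / 2) \<le> 1 powr (- 3 / 2)" by (intro powr_mono2') auto
  then show "norm (shadow_coeff j) \<le> 1 * norm (cm j)"
    by (simp add: shadow_coeff_def norm_mult mult_left_le)
qed

lemma shadow_holomorphic: "shadow holomorphic_on {z. 0 < Im z}"
  unfolding shadow_def[abs_def] q_pow_def
  by (intro holomorphic_intros q_series_holomorphic shadow_coeff) auto

text \<open>The antilinear coefficient is explicit because it defines the shadow; the linear one
  stays an anonymous continuous \<open>p\<close>, as it enters the later arguments only through the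
  continuity required for a primitive.\<close>

lemma nonhol_derivative:
  "\<exists>p. continuous_on {z. 0 < Im z} p \<and> (\<forall>z. 0 < Im z \<longrightarrow>
    (nonhol has_derivative (\<lambda>v. p z * v
      + (- (shadow_factor (Im z) * cnj (q_series 23 shadow_coeff z))) * cnj v)) (at z))"
proof -
  define l where "l = (\<lambda>j::nat. 24 * real j + 23)"
  have l: "1 \<le> l j" "0 < l j" for j by (auto simp: l_def)
  define f where "f = (\<lambda>j z. cm j * nonhol_term (l j) z)"
  define a where "a = (\<lambda>j z. cm j * (- (2 * of_real pi * \<i> * of_real (l j / 24) * nonhol_term (l j) z) + shadow_term (l j) z))"
  define b where "b = (\<lambda>j z. cm j * (- shadow_term (l j) z))"
  have der: "(f j has_derivative (\<lambda>v. a j z * v + b j z * cnj v)) (at z)" if "0 < Im z" for j z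
  proof -
    have eq: "k * (x * v + y * w) = (k * x) * v + (k * y) * w" for k x y v w :: complex
      by (simp add: algebra_simps)
    show ?thesis unfolding f_def a_def b_def
      using has_derivative_mult_right[OF nonhol_term_has_derivative[OF l(2)[of j] that, folded shadow_term_def], of "cm j"]
      by (rule has_derivative_eq_rhs) (simp only: eq)
  qed
  have bound: "\<exists>M. summable M \<and> (\<forall>j z. Y < Im z \<longrightarrow>
      norm (f j z) \<le> M j \<and> norm (a j z) \<le> M j \<and> norm (b j z) \<le> M j)" if Y: "0 < Y" for Y
  proof -
    obtain K where K: "\<And>r z. 1 \<le> r \<Longrightarrow> Y < Im z \<Longrightarrow>
      norm (nonhol_term r z) \<le> K * exp (- (pi * Y / 12) * r) \<and>
      norm (shadow_term r z) \<le> K * exp (- (pi * Y / 12) * r)"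
      using nonhol_term_bound[OF Y] by blast
    define M where "M = (\<lambda>j. K * (norm (cm j) * (1 + pi / 12 * l j) * exp (- (pi * Y / 12) * l j)))"
    have "summable M" unfolding M_def l_def
      using subexponential_summable[OF cm, of "pi / 12" "pi * Y / 12" 23] Y by (intro summable_mult) simp
    moreover have "norm (f j z) \<le> M j \<and> norm (a j z) \<le> M j \<and> norm (b j z) \<le> M j" if z: "Y < Im z" for j z
    proof -
      define E where "E = K * exp (- (pi * Y / 12) * l j)"
      have n: "norm (nonhol_term (l j) z) \<le> E" and s: "norm (shadow_term (l j) z) \<le> E"
        using K[OF l(1) z] by (auto simp: E_def)
      have E: "0 \<le> E" using n norm_ge_zero order_trans by blast
      have M: "M j = norm (cm j) * ((1 + pi / 12 * l j) * E)" by (simp add: M_def E_def mult_ac)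
      have E1: "E \<le> (1 + pi / 12 * l j) * E"
        using E l(2)[of j] mult_right_mono[of 1 "1 + pi / 12 * l j" E] by simp
      have "norm (- (2 * of_real pi * \<i> * of_real (l j / 24) * nonhol_term (l j) z) + shadow_term (l j) z)
          \<le> norm (2 * of_real pi * \<i> * of_real (l j / 24) * nonhol_term (l j) z) + norm (shadow_term (l j) z)"
        using norm_triangle_ineq[of "- (2 * of_real pi * \<i> * of_real (l j / 24) * nonhol_term (l j) z)"] by simp
      also have "\<dots> = pi / 12 * l j * norm (nonhol_term (l j) z) + norm (shadow_term (l j) z)"
        using l(2)[of j] by (simp add: norm_mult)
      also have "\<dots> \<le> pi / 12 * l j * E + E"
        using l(2)[of j] n s by (intro add_mono mult_left_mono) auto
      finally have "norm (- (2 * of_real pi * \<i> * of_real (l j / 24) * nonhol_term (l j) z) + shadow_term (l j) z)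
          \<le> (1 + pi / 12 * l j) * E" by (simp only: distrib_right mult_1 add.commute)
      moreover have "norm (nonhol_term (l j) z) \<le> (1 + pi / 12 * l j) * E"
        "norm (- shadow_term (l j) z) \<le> (1 + pi / 12 * l j) * E"
        using order_trans[OF n E1] order_trans[OF s E1] by simp_all
      ultimately show ?thesis unfolding M f_def a_def b_def norm_mult
        by (intro conjI mult_left_mono norm_ge_zero)
    qed
    ultimately show ?thesis by blast
  qed
  have c_nh: "continuous_on {z. 0 < Im z} (nonhol_term (l j))" for j
    by (rule continuous_on_has_derivative[OF nonhol_term_has_derivative]) (use l in auto)
  have c_sh: "continuous_on {z. 0 < Im z} (shadow_term (l j))" for j
    unfolding shadow_term_def[abs_def] q_pow_def
    by (intro continuous_intros continuous_on_shadow_factor)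
  have cont_a: "continuous_on {z. 0 < Im z} (\<lambda>z. \<Sum>j. a j z)"
  proof (rule continuous_on_suminf_half_planes)
    show "continuous_on {z. 0 < Im z} (a j)" for j
      unfolding a_def by (intro continuous_intros c_nh c_sh)
  next
    fix Y :: real assume "0 < Y"
    from bound[OF this] obtain M where "summable M"
      "\<And>j z. Y < Im z \<Longrightarrow> norm (f j z) \<le> M j \<and> norm (a j z) \<le> M j \<and> norm (b j z) \<le> M j"
      by (elim exE conjE) simp
    then show "\<exists>M. summable M \<and> (\<forall>j z. Y < Im z \<longrightarrow> norm (a j z) \<le> M j)"
      by (intro exI[of _ M]) simp
  qed
  have "(nonhol has_derivative (\<lambda>v. (\<Sum>j. a j z) * v
      + (- (shadow_factor (Im z) * cnj (q_series 23 shadow_coeff z))) * cnj v)) (at z)" if z: "0 < Im z" for z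
  proof -
    have "0 < Im z / 2" using z by simp
    from bound[OF this] obtain M where M: "summable M" "\<And>j w. Im z / 2 < Im w \<Longrightarrow>
      norm (f j w) \<le> M j \<and> norm (a j w) \<le> M j \<and> norm (b j w) \<le> M j"
      by (elim exE conjE) simp
    have "((\<lambda>z. \<Sum>j. f j z) has_derivative (\<lambda>v. (\<Sum>j. a j z) * v + (\<Sum>j. b j z) * cnj v)) (at z)"
    proof (rule suminf_has_derivative_cnj[where S = "{w. Im z / 2 < Im w}" and M = M])
      fix j w assume w: "w \<in> {w. Im z / 2 < Im w}"
      show "(f j has_derivative (\<lambda>v. a j w * v + b j w * cnj v)) (at w)"
        by (rule der) (use w z in simp)
      show "norm (f j w) \<le> M j" "norm (a j w) \<le> M j" "norm (b j w) \<le> M j"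
        using M(2)[of w j] w by simp_all
    next
      show "open {w. Im z / 2 < Im w}" by (rule open_halfspace_Im_gt)
      show "convex {w. Im z / 2 < Im w}" by (rule convex_halfspace_Im_gt)
      show "z \<in> {w. Im z / 2 < Im w}" using z by simp
      show "summable M" by (rule M(1))
    qed
    moreover have "(\<Sum>j. b j z) = - (shadow_factor (Im z) * cnj (q_series 23 shadow_coeff z))"
    proof -
      have s: "summable (\<lambda>j. shadow_coeff j * q_pow ((24 * real j + 23) / 24) z)"
        by (rule q_series_summable[OF shadow_coeff _ z]) simp
      have "(\<lambda>j. cnj (shadow_coeff j * q_pow ((24 * real j + 23) / 24) z)) sums cnj (q_series 23 shadow_coeff z)"
        unfolding q_series_def by (rule bounded_linear.sums[OF bounded_linear_cnj summable_sums[OF s]])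
      then have "(\<lambda>j. - shadow_factor (Im z) * cnj (shadow_coeff j * q_pow ((24 * real j + 23) / 24) z))
          sums (- shadow_factor (Im z) * cnj (q_series 23 shadow_coeff z))" by (rule sums_mult)
      moreover have "- shadow_factor (Im z) * cnj (shadow_coeff j * q_pow ((24 * real j + 23) / 24) z) = b j z" for j
        by (simp add: b_def shadow_term_def shadow_coeff_def l_def)
      ultimately have "(\<lambda>j. b j z) sums (- shadow_factor (Im z) * cnj (q_series 23 shadow_coeff z))"
        by (simp only:)
      then show ?thesis by (simp only: sums_iff mult_minus_left)
    qed
    moreover have "nonhol = (\<lambda>z. \<Sum>j. f j z)" by (simp add: nonhol_def[abs_def] f_def l_def)
    ultimately show ?thesis by simp
  qed
  then show ?thesis using cont_a by blast
qed

lemma form_derivative: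
  "\<exists>p. continuous_on {z. 0 < Im z} p \<and> (\<forall>z. 0 < Im z \<longrightarrow>
    (form has_derivative (\<lambda>v. p z * v + shadow_factor (Im z) * cnj (shadow z) * cnj v)) (at z))"
proof -
  obtain p where p: "continuous_on {z. 0 < Im z} p" "\<And>z. 0 < Im z \<Longrightarrow>
    (nonhol has_derivative (\<lambda>v. p z * v
      + (- (shadow_factor (Im z) * cnj (q_series 23 shadow_coeff z))) * cnj v)) (at z)"
    using nonhol_derivative by blast
  define a where "a = (\<lambda>z. deriv (q_series 1 cp) z
    + (2 * of_real pi * \<i> * of_real (of_int m / 24) * sing_term (of_int m) z - shadow_factor (Im z) *
         cnj (of_real (of_int m powr (- 3 / 2)) * q_pow (- of_int m / 24) z)) + p z)"
  have m: "0 < real_of_int m" using m_pos by simp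
  have hol: "q_series 1 cp holomorphic_on {z. 0 < Im z}" by (rule q_series_holomorphic[OF cp]) simp
  have "continuous_on {z. 0 < Im z} (deriv (q_series 1 cp))"
    by (intro holomorphic_on_imp_continuous_on holomorphic_deriv hol open_halfspace_Im_gt)
  moreover have "continuous_on {z. 0 < Im z} (sing_term (of_int m))"
    by (rule continuous_on_has_derivative[OF sing_term_has_derivative[OF m]]) auto
  ultimately have "continuous_on {z. 0 < Im z} a"
    unfolding a_def q_pow_def by (intro continuous_intros continuous_on_shadow_factor p(1))
  moreover have "(form has_derivative (\<lambda>v. a z * v + shadow_factor (Im z) * cnj (shadow z) * cnj v)) (at z)"
    if z: "0 < Im z" for z
  proof -
    have "(q_series 1 cp has_derivative (\<lambda>v. deriv (q_series 1 cp) z * v)) (at z)"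
      using holomorphic_derivI[OF hol open_halfspace_Im_gt, of z] z by (simp add: has_field_derivative_def)
    note der = has_derivative_add[OF has_derivative_add[OF this sing_term_has_derivative[OF m z]] p(2)[OF z]]
    have eq: "x1 * v + (x2 * v + e * w) + (x3 * v + - f * w) = (x1 + x2 + x3) * v + (e - f) * w"
      for x1 x2 x3 e f v w :: complex by (simp add: algebra_simps)
    have "shadow_factor (Im z) * cnj (shadow z)
      = shadow_factor (Im z) * cnj (of_real (of_int m powr (- 3 / 2)) * q_pow (- of_int m / 24) z)
        - shadow_factor (Im z) * cnj (q_series 23 shadow_coeff z)"
      unfolding shadow_def by (simp only: complex_cnj_diff right_diff_distrib)
    then show ?thesis unfolding form_def[abs_def]
      by (intro has_derivative_eq_rhs[OF der]) (simp only: a_def eq)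
  qed
  ultimately show ?thesis by blast
qed

end

section \<open>Inversion and reflection acting on forms and shadows\<close>

lemma exp_five_pi_i_half: "exp (\<i> * of_real (pi / 2) + \<i> * of_real (2 * pi)) = \<i>"
  by (simp only: exp_add cis_conv_exp[symmetric]) simp

text \<open>Reflection shifts the conjugated logarithm by \<open>\<i> * pi\<close>, and 5/2 of this
  is a quarter turn modulo full turns.\<close>

lemma powr_minus_cnj:
  assumes "0 < Im z"
  shows "(- cnj z) powr (5 / 2) = \<i> * cnj (z powr (5 / 2))"
proof -
  have z: "z \<noteq> 0" using assms by auto
  have e: "5 / 2 * Ln (- cnj z) = 5 / 2 * cnj (Ln z) + (\<i> * of_real (pi / 2) + \<i> * of_real (2 * pi))"
    unfolding Ln_minus_cnj[OF assms] by (simp add: field_simps)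
  have "(- cnj z) powr (5 / 2) = exp (5 / 2 * cnj (Ln z) + (\<i> * of_real (pi / 2) + \<i> * of_real (2 * pi)))"
    unfolding e[symmetric] using z by (simp add: powr_def)
  also have "\<dots> = exp (cnj (5 / 2 * Ln z)) * \<i>"
    unfolding exp_add[of "5 / 2 * cnj (Ln z)"] exp_five_pi_i_half by simp
  also have "\<dots> = \<i> * cnj (z powr (5 / 2))"
    using z by (simp add: powr_def exp_cnj)
  finally show ?thesis .
qed

text \<open>The two logarithms add up to \<open>\<i> * pi\<close>, giving the same quarter turn as
  in \<open>powr_minus_cnj\<close>. The agreement of these phases is why the multiplier relation
  \<open>\<epsilon> * \<epsilon> * \<i> = 1\<close> makes reflected shadows transform like
  shadows.\<close>

lemma powr_minus_one_over:
  assumes "0 < Im z"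
  shows "(- 1 / z) powr (5 / 2) * z powr (5 / 2) = \<i>"
proof -
  have z: "z \<noteq> 0" using assms by auto
  have e: "5 / 2 * Ln (- 1 / z) + 5 / 2 * Ln z = \<i> * of_real (pi / 2) + \<i> * of_real (2 * pi)"
    unfolding Ln_minus_one_over[OF assms] by (simp add: field_simps)
  have "(- 1 / z) powr (5 / 2) * z powr (5 / 2) = exp (\<i> * of_real (pi / 2) + \<i> * of_real (2 * pi))"
    unfolding e[symmetric] exp_add using z by (simp add: powr_def)
  also have "\<dots> = \<i>" by (rule exp_five_pi_i_half)
  finally show ?thesis .
qed

lemma norm_powr_five_halves: "norm (z powr (5 / 2)) = norm z powr (5 / 2)" for z :: complex
  by (simp add: powr_def exp_eq_polar norm_mult)

lemma Im_minus_one_over: "Im (- 1 / z) = Im z / (norm z)\<^sup>2"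
  by (simp add: Im_divide cmod_power2)

text \<open>On the half plane this is \<open>z powr (- 1 / 2)\<close>, kept in the shape in which it
  emerges from differentiating the transformation law of weight 5/2.\<close>

definition shadow_automorphy :: "complex \<Rightarrow> complex" where
  "shadow_automorphy z = z\<^sup>2 * cnj (z powr (5 / 2)) / of_real (norm z ^ 5)"

lemma shadow_factor_minus_one_over:
  assumes "0 < Im z"
  shows "shadow_factor (Im (- 1 / z)) = shadow_factor (Im z) * of_real (norm z ^ 5)"
proof -
  have z: "0 < norm z" using assms by auto
  have "((norm z)\<^sup>2) powr (- 5 / 2) = norm z powr (- 5)"
    using z by (simp add: powr_powr flip: powr_numeral)
  then have "((norm z)\<^sup>2) powr (- 5 / 2) = inverse (norm z ^ 5)"
    using z by (simp add: powr_minus powr_numeral)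
  then have "(Im z / (norm z)\<^sup>2) powr (- 5 / 2) = Im z powr (- 5 / 2) * norm z ^ 5"
    using assms z by (simp add: powr_divide field_simps)
  then show ?thesis unfolding Im_minus_one_over by (simp add: shadow_factor_def)
qed

lemma shadow_factor_nonzero: "0 < y \<Longrightarrow> shadow_factor y \<noteq> 0"
  by (simp add: shadow_factor_def)

lemma norm_shadow_automorphy:
  assumes "0 < Im z"
  shows "norm (shadow_automorphy z) = norm z powr (- 1 / 2)"
proof -
  have z: "0 < norm z" using assms by auto
  have "norm (shadow_automorphy z) = norm z powr 2 * norm z powr (5 / 2) / norm z powr 5"
    using z by (simp add: shadow_automorphy_def norm_mult norm_divide norm_power norm_powr_five_halves powr_numeral)
  also have "\<dots> = norm z powr (2 + 5 / 2 - 5)" by (simp only: powr_add powr_diff)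
  finally show ?thesis by simp
qed

context h_series
begin

text \<open>High up, the principal part has modulus at least \<open>e\<close>, whereas the series
  with positive exponents is smaller than \<open>e\<close>.\<close>

lemma shadow_not_identically_zero: "\<exists>z. 0 < Im z \<and> shadow z \<noteq> 0"
proof -
  define e :: real where "e = of_int m powr (- 3 / 2)"
  have e: "0 < e" using m_pos by (simp add: e_def)
  obtain Y where Y: "\<And>z. Y \<le> Im z \<Longrightarrow> norm (q_series 23 shadow_coeff z) < e"
    using q_series_decay[OF shadow_coeff _ e, of 23] by auto
  define z where "z = Complex 0 (max Y 1)"
  have "norm (q_pow (- of_int m / 24) z) \<ge> 1"
    using m_pos by (simp add: norm_q_pow z_def)
  then have "e * 1 \<le> norm (of_real e * q_pow (- of_int m / 24) z)"
    using e unfolding norm_mult by (intro mult_mono) auto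
  moreover have "norm (q_series 23 shadow_coeff z) < e" by (rule Y) (simp add: z_def)
  ultimately have "shadow z \<noteq> 0" unfolding shadow_def e_def[symmetric] by auto
  moreover have "0 < Im z" by (simp add: z_def)
  ultimately show ?thesis by blast
qed

lemma shadow_minus_cnj:
  assumes z: "0 < Im z"
  shows "cnj (shadow (- cnj z)) = of_real (of_int m powr (- 3 / 2)) * q_pow (- of_int m / 24) z
    - q_series 23 (\<lambda>j. cnj (shadow_coeff j)) z"
  unfolding shadow_def
  by (simp add: cnj_q_pow_minus_cnj cnj_q_series_minus_cnj[OF shadow_coeff _ z])

context
  fixes \<epsilon> :: complex
  assumes modular: "\<And>z. 0 < Im z \<Longrightarrow> form (- 1 / z) = \<epsilon> * z powr (5 / 2) * form z"
begin

text \<open>Differentiate the transformation law and compare antilinear parts. The derivative of the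
  holomorphic factor \<open>z powr (5 / 2)\<close> contributes only to the linear part.\<close>

lemma shadow_modular:
  assumes z: "0 < Im z"
  shows "shadow (- 1 / z) = cnj \<epsilon> * shadow_automorphy z * shadow z"
proof -
  let ?w = "- 1 / z"
  have z0: "z \<noteq> 0" "z \<notin> \<real>\<^sub>\<le>\<^sub>0" using z by (auto simp: complex_nonpos_Reals_iff)
  have w: "0 < Im ?w" unfolding Im_minus_one_over using z z0 by simp
  obtain p where p: "\<And>z. 0 < Im z \<Longrightarrow>
    (form has_derivative (\<lambda>v. p z * v + shadow_factor (Im z) * cnj (shadow z) * cnj v)) (at z)"
    using form_derivative by blast
  have "((\<lambda>z. - 1 / z) has_field_derivative (1 / z\<^sup>2)) (at z)"
    using z0 by (auto intro!: derivative_eq_intros simp: power2_eq_square)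
  then have inv: "((\<lambda>z. - 1 / z) has_derivative (\<lambda>v. 1 / z\<^sup>2 * v)) (at z)"
    by (simp only: has_field_derivative_def)
  let ?b = "shadow_factor (Im ?w) * cnj (shadow ?w) * cnj (1 / z\<^sup>2)"
  have "((\<lambda>z. form (- 1 / z)) has_derivative (\<lambda>v. (p ?w * (1 / z\<^sup>2)) * v + ?b * cnj v)) (at z)"
    using has_derivative_compose[OF inv p[OF w]]
    by (rule has_derivative_eq_rhs) (simp only: complex_cnj_mult mult.assoc)
  then have 1: "((\<lambda>z. \<epsilon> * z powr (5 / 2) * form z) has_derivative (\<lambda>v. (p ?w * (1 / z\<^sup>2)) * v + ?b * cnj v)) (at z)"
    by (rule has_derivative_transform_within_open[OF _ open_halfspace_Im_gt[of 0]]) (use z modular in auto)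
  define d where "d = 5 / 2 * z powr (5 / 2 - 1)"
  have "((\<lambda>z. \<epsilon> * z powr (5 / 2)) has_field_derivative \<epsilon> * d) (at z)"
    unfolding d_def using z0 by (intro DERIV_cmult has_field_derivative_powr) auto
  then have "((\<lambda>z. \<epsilon> * z powr (5 / 2)) has_derivative (\<lambda>v. \<epsilon> * d * v)) (at z)"
    by (simp only: has_field_derivative_def)
  from has_derivative_mult[OF this p[OF z]]
  have 2: "((\<lambda>z. \<epsilon> * z powr (5 / 2) * form z) has_derivative
      (\<lambda>v. (\<epsilon> * z powr (5 / 2) * p z + \<epsilon> * d * form z) * v
        + \<epsilon> * z powr (5 / 2) * (shadow_factor (Im z) * cnj (shadow z)) * cnj v)) (at z)"
    by (rule has_derivative_eq_rhs) (simp add: fun_eq_iff algebra_simps)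
  have "?b = \<epsilon> * z powr (5 / 2) * (shadow_factor (Im z) * cnj (shadow z))"
    by (rule has_derivative_cnj_unique[OF 1 2])
  then have "shadow_factor (Im z) * (of_real (norm z ^ 5) * cnj (shadow ?w) * cnj (1 / z\<^sup>2))
      = shadow_factor (Im z) * (\<epsilon> * z powr (5 / 2) * cnj (shadow z))"
    unfolding shadow_factor_minus_one_over[OF z] by (simp only: mult_ac)
  then have "of_real (norm z ^ 5) * cnj (shadow ?w) * cnj (1 / z\<^sup>2) = \<epsilon> * z powr (5 / 2) * cnj (shadow z)"
    by (rule mult_left_cancel[THEN iffD1, OF shadow_factor_nonzero[OF z]])
  then have "cnj (of_real (norm z ^ 5) * cnj (shadow ?w) * cnj (1 / z\<^sup>2)) = cnj (\<epsilon> * z powr (5 / 2) * cnj (shadow z))"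
    by (simp only:)
  then have "of_real (norm z ^ 5) * shadow ?w / z\<^sup>2 = cnj \<epsilon> * cnj (z powr (5 / 2)) * shadow z"
    by simp
  then show ?thesis using z0(1) unfolding shadow_automorphy_def by (simp add: field_simps)
qed

text \<open>A vanishing form would have a vanishing \<open>cnj z\<close>-derivative, hence a
  vanishing shadow.\<close>

lemma form_not_identically_zero: "\<exists>z. 0 < Im z \<and> form z \<noteq> 0"
proof (rule ccontr)
  assume "\<not> ?thesis"
  then have form0: "form z = 0" if "0 < Im z" for z using that by blast
  obtain z where z: "0 < Im z" "shadow z \<noteq> 0" using shadow_not_identically_zero by blast
  obtain p where p: "\<And>z. 0 < Im z \<Longrightarrow>
    (form has_derivative (\<lambda>v. p z * v + shadow_factor (Im z) * cnj (shadow z) * cnj v)) (at z)"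
    using form_derivative by blast
  have "((\<lambda>z. 0) has_derivative (\<lambda>v. p z * v + shadow_factor (Im z) * cnj (shadow z) * cnj v)) (at z)"
    by (rule has_derivative_transform_within_open[OF p[OF z(1)] open_halfspace_Im_gt[of 0]])
      (use z form0 in auto)
  moreover have "((\<lambda>z. 0::complex) has_derivative (\<lambda>v. 0 * v + 0 * cnj v)) (at z)" by simp
  ultimately have "shadow_factor (Im z) * cnj (shadow z) = 0" by (rule has_derivative_cnj_unique)
  then show False using z shadow_factor_nonzero by simp
qed

lemma multiplier_square: "\<epsilon> * \<epsilon> * \<i> = 1"
proof -
  obtain z where z: "0 < Im z" "form z \<noteq> 0" using form_not_identically_zero by blast
  have z0: "z \<noteq> 0" using z by auto
  have w: "0 < Im (- 1 / z)" unfolding Im_minus_one_over using z z0 by simp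
  have "form z = form (- 1 / (- 1 / z))" using z0 by simp
  also have "\<dots> = \<epsilon> * (- 1 / z) powr (5 / 2) * (\<epsilon> * z powr (5 / 2) * form z)"
    by (simp only: modular[OF w] modular[OF z(1)])
  also have "\<dots> = \<epsilon> * \<epsilon> * ((- 1 / z) powr (5 / 2) * z powr (5 / 2)) * form z" by (simp only: mult_ac)
  finally show ?thesis using z(2) unfolding powr_minus_one_over[OF z(1)] by simp
qed

lemma norm_multiplier: "norm \<epsilon> = 1"
proof -
  have "norm (\<epsilon> * \<epsilon> * \<i>) = 1" by (simp only: multiplier_square norm_one)
  then have "norm \<epsilon> ^ 2 = 1" by (simp add: norm_mult power2_eq_square)
  then show ?thesis by (simp add: power2_eq_1_iff) (metis norm_ge_zero neg_0_le_iff_le not_one_le_zero)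
qed

lemma cnj_multiplier: "cnj \<epsilon> = \<epsilon> * \<i>"
proof -
  have "\<epsilon> * cnj \<epsilon> = 1" using norm_multiplier complex_norm_square[of \<epsilon>] by simp
  then have "\<epsilon> * cnj \<epsilon> = \<epsilon> * (\<epsilon> * \<i>)" using multiplier_square by (simp add: mult.assoc)
  moreover have "\<epsilon> \<noteq> 0" using norm_multiplier by auto
  ultimately show ?thesis by simp
qed

text \<open>The principal part has a real coefficient and cancels in the difference \<open>G\<close>
  of the shadow and its reflection. So \<open>G\<close> has positive exponents only and still
  transforms with weight \<open>- 1 / 2\<close>, which forces it to be 0.\<close>

lemma shadow_symmetric:
  assumes z: "0 < Im z"
  shows "cnj (shadow (- cnj z)) = shadow z"
proof -
  define c where "c = (\<lambda>j. cnj (shadow_coeff j) - shadow_coeff j)"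
  have c: "subexponential c"
  proof (rule subexponential_mult_bounded[OF shadow_coeff, where B = 2])
    show "norm (c j) \<le> 2 * norm (shadow_coeff j)" for j
      using norm_triangle_ineq4[of "cnj (shadow_coeff j)" "shadow_coeff j"] by (simp add: c_def)
  qed
  define G where "G = q_series 23 c"
  have G: "G z = shadow z - cnj (shadow (- cnj z))" if z: "0 < Im z" for z
  proof -
    have "q_series 23 c z = q_series 23 (\<lambda>j. cnj (shadow_coeff j)) z - q_series 23 shadow_coeff z"
      unfolding q_series_def c_def
      by (simp only: left_diff_distrib)
        (rule suminf_diff[symmetric]; rule q_series_summable; use z in \<open>simp add: shadow_coeff subexponential_cnj\<close>)
    then show ?thesis unfolding G_def shadow_minus_cnj[OF z] by (simp add: shadow_def)
  qed
  have "G z = 0"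
  proof (rule negative_weight_cusp_form_eq_0[where G = G and z = z and k = "- 1 / 2"])
    show "G holomorphic_on {z. 0 < Im z}" unfolding G_def by (rule q_series_holomorphic[OF c]) simp
    show "\<exists>Y. \<forall>z. Y \<le> Im z \<longrightarrow> norm (G z) < e" if "0 < e" for e
      unfolding G_def by (rule q_series_decay[OF c _ that]) simp
    fix z :: complex assume z: "0 < Im z"
    show "norm (G (z + 1)) = norm (G z)"
      unfolding G_def using q_series_periodic[OF c _ z, of 23] by (simp add: norm_mult)
    have z0: "z \<noteq> 0" using z by auto
    have w: "0 < Im (- 1 / z)" unfolding Im_minus_one_over using z z0 by simp
    have "- cnj (- 1 / z) = - 1 / (- cnj z)" by simp
    then have "cnj (shadow (- cnj (- 1 / z))) = cnj (cnj \<epsilon> * shadow_automorphy (- cnj z) * shadow (- cnj z))"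
      using shadow_modular[of "- cnj z"] z by simp
    also have "\<dots> = cnj \<epsilon> * shadow_automorphy z * cnj (shadow (- cnj z))"
    proof -
      \<comment> \<open>Conjugating the reflected factor gives
        \<open>\<i> * shadow_automorphy z\<close>, and \<open>\<epsilon> * \<i>\<close> is
        \<open>cnj \<epsilon>\<close> again.\<close>
      have "\<epsilon> * cnj (shadow_automorphy (- cnj z)) = cnj \<epsilon> * shadow_automorphy z"
        by (simp add: shadow_automorphy_def powr_minus_cnj[OF z] cnj_multiplier)
      then show ?thesis by (simp only: complex_cnj_mult complex_cnj_cnj)
    qed
    finally have "G (- 1 / z) = cnj \<epsilon> * shadow_automorphy z * G z"
      unfolding G[OF w] G[OF z] shadow_modular[OF z] by (simp only: right_diff_distrib)
    then show "norm (G (- 1 / z)) = norm z powr (- 1 / 2) * norm (G z)"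
      by (simp only: norm_mult complex_mod_cnj norm_multiplier norm_shadow_automorphy[OF z] mult_1)
  qed (use z in auto)
  then show ?thesis using G[OF z] by simp
qed

end

end

subsection \<open>Fourier coefficients and the pairing\<close>

text \<open>The sign \<open>\<sigma>\<close> covers series in positive and in negative powers. The
  frequency \<open>t\<close> may be fractional; it only has to complement the offset
  \<open>s / 24\<close> to an integer, after which orthogonality selects
  \<open>\<sigma> * j + n = 0\<close>.\<close>

lemma fourier_coefficient_has_integral:
  fixes a :: "nat \<Rightarrow> complex" and \<sigma> n :: int
  assumes a: "summable (\<lambda>j. norm (a j))" and \<sigma>: "\<sigma> = 1 \<or> \<sigma> = - 1"
    and t: "of_int \<sigma> * s / 24 + t = of_int n"
  shows "((\<lambda>x. (\<Sum>j. a j * cis (2 * pi * (of_int \<sigma> * (24 * real j + s) / 24) * x)) * cis (2 * pi * t * x))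
    has_integral (if 0 \<le> - \<sigma> * n then a (nat (- \<sigma> * n)) else 0)) {0..1}"
proof -
  have prod: "cis (2 * pi * (of_int \<sigma> * (24 * real j + s) / 24) * x) * cis (2 * pi * t * x)
      = cis (2 * pi * of_int (\<sigma> * int j + n) * x)" for j x
  proof -
    have "2 * pi * (of_int \<sigma> * (24 * real j + s) / 24) * x + 2 * pi * t * x
        = 2 * pi * (of_int \<sigma> * real j + (of_int \<sigma> * s / 24 + t)) * x" by (simp add: field_simps)
    also have "\<dots> = 2 * pi * of_int (\<sigma> * int j + n) * x" unfolding t by simp
    finally show ?thesis by (simp only: cis_mult)
  qed
  have int: "integral {0..1} (\<lambda>x. cis (2 * pi * (of_int \<sigma> * (24 * real j + s) / 24) * x) * cis (2 * pi * t * x))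
      = (if \<sigma> * int j + n = 0 then 1 else 0)" for j
    unfolding prod by (rule integral_cis_int)
  have "((\<lambda>x. (\<Sum>j. a j * cis (2 * pi * (of_int \<sigma> * (24 * real j + s) / 24) * x)) * cis (2 * pi * t * x))
    has_integral (\<Sum>j. a j * (if \<sigma> * int j + n = 0 then 1 else 0))) {0..1}"
    unfolding int[symmetric]
    by (rule integral_suminf_mult[OF a]) (auto intro!: continuous_intros)
  moreover have "(\<Sum>j. a j * (if \<sigma> * int j + n = 0 then 1 else 0))
      = (if 0 \<le> - \<sigma> * n then a (nat (- \<sigma> * n)) else 0)"
  proof (cases "0 \<le> - \<sigma> * n")
    case True
    have "(\<lambda>j. a j * (if \<sigma> * int j + n = 0 then 1 else 0)) = (\<lambda>j. if j = nat (- \<sigma> * n) then a j else 0)"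
      using \<sigma> True by (auto simp: fun_eq_iff)
    then show ?thesis using True sums_single[of "nat (- \<sigma> * n)" a] by (simp add: sums_iff)
  next
    case False
    then have "(\<lambda>j. a j * (if \<sigma> * int j + n = 0 then 1 else 0)) = (\<lambda>j. 0)"
      using \<sigma> by (auto simp: fun_eq_iff)
    with False show ?thesis by simp
  qed
  ultimately show ?thesis by simp
qed

lemma q_pow_Complex:
  "q_pow (r / 24) (Complex x y) = of_real (exp (- (pi * y / 12) * r)) * cis (2 * pi * (r / 24) * x)"
  by (simp add: q_pow_cis mult_ac)

lemma q_pow_plus_one: "q_pow r (z + 1) = cis (2 * pi * r) * q_pow r z"
  by (simp add: q_pow_cis cis_mult[symmetric] distrib_left)

lemma cis_cong_int: "cis (2 * pi * r) = cis (2 * pi * s)" if "r - s = of_int k"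
proof -
  have "2 * pi * r = 2 * pi * s + 2 * pi * of_int k" unfolding that[symmetric] by (simp add: algebra_simps)
  then have "cis (2 * pi * r) = cis (2 * pi * s) * cis (2 * pi * of_int k)" by (simp only: cis_mult)
  moreover have "cis (2 * pi * of_int k) = 1" by (rule cis_multiple_2pi) simp
  ultimately show ?thesis by simp
qed

lemma Complex_curve_continuous: "continuous_on {0..1} (\<lambda>x. Complex x y)"
  unfolding Complex_eq by (intro continuous_intros)

lemma q_series_coefficients_unique:
  assumes c: "subexponential c" and d: "subexponential d" and s: "0 \<le> s"
    and eq: "\<And>z. 0 < Im z \<Longrightarrow> q_series s c z = q_series s d z"
  shows "c k = d k"
proof -
  have F: "((\<lambda>x. q_series s c (Complex x 1) * cis (2 * pi * (- real k - s / 24) * x))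
      has_integral c k * of_real (exp (- (pi * 1 / 12) * (24 * real k + s)))) {0..1}"
    if c: "subexponential c" for c
  proof -
    have "summable (\<lambda>j. norm (c j * of_real (exp (- (pi * 1 / 12) * (24 * real j + s)))))"
      using q_series_summable_norm[OF c s, of 1] by (simp add: norm_mult)
    from fourier_coefficient_has_integral[OF this, of 1 s "- real k - s / 24" "- int k"]
    show ?thesis by (simp add: q_series_def q_pow_Complex mult.assoc)
  qed
  have "((\<lambda>x. q_series s c (Complex x 1) * cis (2 * pi * (- real k - s / 24) * x))
      has_integral d k * of_real (exp (- (pi * 1 / 12) * (24 * real k + s)))) {0..1}"
    using F[OF d] by (simp add: eq)
  from has_integral_unique[OF F[OF c] this]
  have "c k * of_real (exp (- (pi * 1 / 12) * (24 * real k + s)))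
      = d k * of_real (exp (- (pi * 1 / 12) * (24 * real k + s)))" .
  then show ?thesis by simp
qed

lemma nonhol_term_Complex:
  "nonhol_term r (Complex x y) = of_real (upper_Gamma (- 3 / 2) (pi * r * y / 6) * exp (pi * y / 12 * r)) * cis (2 * pi * (- r / 24) * x)"
  unfolding nonhol_term_def q_pow_Complex by simp

context h_series
begin

lemma nonhol_summable_norm:
  assumes y: "0 < Im z"
  shows "summable (\<lambda>j. norm (cm j * nonhol_term (24 * real j + 23) z))"
proof -
  have "0 < Im z / 2" using y by simp
  from nonhol_term_bound[OF this] obtain K where K: "\<And>r w. 1 \<le> r \<Longrightarrow> Im z / 2 < Im w \<Longrightarrow>
      norm (nonhol_term r w) \<le> K * exp (- (pi * (Im z / 2) / 12) * r)" by blast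
  have "summable (\<lambda>j. K * (norm (cm j) * exp (- (pi * (Im z / 2) / 12) * (24 * real j + 23))))"
    by (intro summable_mult q_series_summable_norm cm) (use y in auto)
  then show ?thesis
  proof (rule summable_comparison_test'[where N = 0])
    fix j
    have "norm (nonhol_term (24 * real j + 23) z) \<le> K * exp (- (pi * (Im z / 2) / 12) * (24 * real j + 23))"
      using y by (intro K) auto
    then have "norm (cm j) * norm (nonhol_term (24 * real j + 23) z)
        \<le> norm (cm j) * (K * exp (- (pi * (Im z / 2) / 12) * (24 * real j + 23)))"
      by (rule mult_left_mono) simp
    then show "norm (norm (cm j * nonhol_term (24 * real j + 23) z))
        \<le> K * (norm (cm j) * exp (- (pi * (Im z / 2) / 12) * (24 * real j + 23)))"
      by (simp add: norm_mult mult_ac)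
  qed
qed

lemma form_continuous: "continuous_on {z. 0 < Im z} form"
proof -
  obtain p where p: "\<And>z. 0 < Im z \<Longrightarrow>
    (form has_derivative (\<lambda>v. p z * v + shadow_factor (Im z) * cnj (shadow z) * cnj v)) (at z)"
    using form_derivative by blast
  show ?thesis by (rule continuous_on_has_derivative[OF p]) simp
qed

context
  fixes M :: nat
  assumes m_eq: "m = 24 * int M + 1"
begin

text \<open>The numerators \<open>24 * j + 1\<close>, \<open>m\<close> and
  \<open>- (24 * j + 23)\<close> are all congruent to 1 modulo 24, so one root of unity serves the
  three parts of the expansion.\<close>

lemma form_periodic:
  assumes z: "0 < Im z"
  shows "form (z + 1) = cis (2 * pi * (1 / 24)) * form z"
proof -
  have "cis (2 * pi * (of_int m / 24)) = cis (2 * pi * (1 / 24))"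
    by (rule cis_cong_int[of _ _ "int M"]) (simp add: m_eq field_simps)
  then have "sing_term (of_int m) (z + 1) = cis (2 * pi * (1 / 24)) * sing_term (of_int m) z"
    unfolding sing_term_def q_pow_plus_one by simp
  moreover have "nonhol (z + 1) = cis (2 * pi * (1 / 24)) * nonhol z"
  proof -
    have "cis (2 * pi * (- (24 * real j + 23) / 24)) = cis (2 * pi * (1 / 24))" for j
      by (rule cis_cong_int[of _ _ "- int j - 1"]) (simp add: field_simps)
    then have "nonhol_term (24 * real j + 23) (z + 1) = cis (2 * pi * (1 / 24)) * nonhol_term (24 * real j + 23) z" for j
      unfolding nonhol_term_def q_pow_plus_one by (simp only: plus_complex.sel one_complex.sel add_0_right mult.left_commute)
    then have "nonhol (z + 1) = (\<Sum>j. cis (2 * pi * (1 / 24)) * (cm j * nonhol_term (24 * real j + 23) z))"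
      unfolding nonhol_def by (simp only: mult.left_commute)
    also have "\<dots> = cis (2 * pi * (1 / 24)) * nonhol z"
      unfolding nonhol_def by (rule suminf_mult[OF summable_norm_cancel[OF nonhol_summable_norm[OF z]]])
    finally show ?thesis .
  qed
  moreover have "q_series 1 cp (z + 1) = cis (2 * pi * (1 / 24)) * q_series 1 cp z"
    using q_series_periodic[OF cp _ z, of 1] by simp
  ultimately show ?thesis unfolding form_def by (simp only: distrib_left)
qed

lemma shadow_periodic:
  assumes z: "0 < Im z"
  shows "shadow (z + 1) = cis (2 * pi * (- 1 / 24)) * shadow z"
proof -
  have "cis (2 * pi * (- of_int m / 24)) = cis (2 * pi * (- 1 / 24))"
    by (rule cis_cong_int[of _ _ "- int M"]) (simp add: m_eq field_simps)
  then have "q_pow (- of_int m / 24) (z + 1) = cis (2 * pi * (- 1 / 24)) * q_pow (- of_int m / 24) z"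
    unfolding q_pow_plus_one by (simp only:)
  moreover have "cis (2 * pi * (23 / 24)) = cis (2 * pi * (- 1 / 24))"
    by (rule cis_cong_int[of _ _ 1]) simp
  then have "q_series 23 shadow_coeff (z + 1) = cis (2 * pi * (- 1 / 24)) * q_series 23 shadow_coeff z"
    using q_series_periodic[OF shadow_coeff _ z, of 23] by (simp only: times_divide_eq_right)
  ultimately show ?thesis unfolding shadow_def by (simp only: right_diff_distrib mult.left_commute)
qed

lemma form_fourier:
  fixes n :: int
  assumes y: "0 < y" and t: "1 / 24 + t = of_int n"
  shows "((\<lambda>x. form (Complex x y) * cis (2 * pi * t * x)) has_integral
    (if n \<le> 0 then cp (nat (- n)) * of_real (exp (- (pi * y / 12) * (24 * real (nat (- n)) + 1))) else 0)
    + (if int M + n = 0 then \<i> * beta_fun (- of_int m * y) * of_real (exp (- (pi * y / 12) * of_int m)) else 0)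
    + (if 1 \<le> n then cm (nat (n - 1)) * of_real (upper_Gamma (- 3 / 2) (pi * (24 * real (nat (n - 1)) + 23) * y / 6)
         * exp (pi * y / 12 * (24 * real (nat (n - 1)) + 23))) else 0)) {0..1}"
proof -
  have t': "t = of_int n - 1 / 24" using t by simp
  have "summable (\<lambda>j. norm (cp j * of_real (exp (- (pi * y / 12) * (24 * real j + 1)))))"
    using q_series_summable_norm[OF cp _ y, of 1] by (simp add: norm_mult)
  from fourier_coefficient_has_integral[OF this, of 1 1 t n] t
  have 1: "((\<lambda>x. q_series 1 cp (Complex x y) * cis (2 * pi * t * x)) has_integral
    (if n \<le> 0 then cp (nat (- n)) * of_real (exp (- (pi * y / 12) * (24 * real (nat (- n)) + 1))) else 0)) {0..1}"
    by (cases "n \<le> 0") (simp_all add: q_series_def q_pow_Complex mult.assoc)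
  let ?S = "\<i> * beta_fun (- of_int m * y) * of_real (exp (- (pi * y / 12) * of_int m))"
  have "integral {0..1} (\<lambda>x. cis (2 * pi * of_int (int M + n) * x)) = (if int M + n = 0 then 1 else 0)"
    by (rule integral_cis_int)
  moreover have "(\<lambda>x. cis (2 * pi * of_int (int M + n) * x)) integrable_on {0..1}"
    by (intro integrable_continuous_real continuous_intros)
  ultimately have "((\<lambda>x. ?S * cis (2 * pi * of_int (int M + n) * x)) has_integral ?S * (if int M + n = 0 then 1 else 0)) {0..1}"
    by (intro has_integral_mult_right) (simp add: has_integral_iff)
  moreover have "?S * cis (2 * pi * of_int (int M + n) * x) = sing_term (of_int m) (Complex x y) * cis (2 * pi * t * x)" for x
  proof -
    have "2 * pi * of_int (int M + n) * x = 2 * pi * (of_int m / 24) * x + 2 * pi * t * x"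
      unfolding t' m_eq by (simp add: field_simps)
    then have c: "cis (2 * pi * of_int (int M + n) * x) = cis (2 * pi * (of_int m / 24) * x) * cis (2 * pi * t * x)"
      by (simp only: cis_mult)
    show ?thesis unfolding c sing_term_def q_pow_Complex complex.sel by (simp only: mult.assoc)
  qed
  ultimately have 2: "((\<lambda>x. sing_term (of_int m) (Complex x y) * cis (2 * pi * t * x)) has_integral
      (if int M + n = 0 then ?S else 0)) {0..1}"
    by (cases "int M + n = 0") simp_all
  define b where "b = (\<lambda>j. cm j * of_real (upper_Gamma (- 3 / 2) (pi * (24 * real j + 23) * y / 6)
         * exp (pi * y / 12 * (24 * real j + 23))))"
  have b: "cm j * nonhol_term (24 * real j + 23) (Complex x y)
      = b j * cis (2 * pi * (of_int (- 1) * (24 * real j + 23) / 24) * x)" for j x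
    unfolding nonhol_term_Complex b_def by simp
  have "norm (cm j * nonhol_term (24 * real j + 23) (Complex 0 y)) = norm (b j)" for j
    unfolding b by (simp add: norm_mult)
  then have "summable (\<lambda>j. norm (b j))" using nonhol_summable_norm[of "Complex 0 y"] y by simp
  \<comment> \<open>The offset of this series is \<open>- 23 / 24\<close>, and
    \<open>- 23 / 24 + t = n - 1\<close>, so the surviving index is
    \<open>j = n - 1\<close>.\<close>
  from fourier_coefficient_has_integral[OF this, of "- 1" 23 t "n - 1"] t
  have "((\<lambda>x. (\<Sum>j. b j * cis (2 * pi * (of_int (- 1) * (24 * real j + 23) / 24) * x)) * cis (2 * pi * t * x))
      has_integral (if 1 \<le> n then b (nat (n - 1)) else 0)) {0..1}"
    by (cases "1 \<le> n") simp_all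
  then have 3: "((\<lambda>x. nonhol (Complex x y) * cis (2 * pi * t * x)) has_integral
      (if 1 \<le> n then b (nat (n - 1)) else 0)) {0..1}"
    unfolding nonhol_def b .
  show ?thesis
    using has_integral_add[OF has_integral_add[OF 1 2] 3]
    unfolding form_def b_def by (simp only: distrib_right)
qed

end

end

lemma (in h_series) form_mult_derivative:
  assumes p: "\<And>z. 0 < Im z \<Longrightarrow>
      (form has_derivative (\<lambda>v. p z * v + shadow_factor (Im z) * cnj (shadow z) * cnj v)) (at z)"
    and g: "g holomorphic_on {z. 0 < Im z}" and z: "0 < Im z"
  shows "((\<lambda>z. form z * g z) has_derivative (\<lambda>v. (p z * g z + form z * deriv g z) * v
    + shadow_factor (Im z) * cnj (shadow z) * g z * cnj v)) (at z)"
proof -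
  have "(g has_derivative (\<lambda>v. deriv g z * v)) (at z)"
    using holomorphic_derivI[OF g open_halfspace_Im_gt, of z] z by (simp add: has_field_derivative_def)
  note der = has_derivative_mult[OF p[OF z] this]
  have eq: "f * (d * v) + (x * v + b * w) * y = (x * y + f * d) * v + b * y * w"
    for f d v x b w y :: complex by (simp add: algebra_simps)
  show ?thesis by (rule has_derivative_eq_rhs[OF der]) (rule ext, rule eq)
qed

section \<open>The pairing of one form with the shadow of another\<close>

locale h_series_pair = A: h_series m cp cm + B: h_series m' cp' cm'
  for m :: int and cp cm :: "nat \<Rightarrow> complex" and m' :: int and cp' cm' :: "nat \<Rightarrow> complex" +
  fixes M M' :: nat and \<epsilon> :: complex
  assumes m_eq: "m = 24 * int M + 1" and m'_eq: "m' = 24 * int M' + 1"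
    and A_modular: "\<And>z. 0 < Im z \<Longrightarrow> A.form (- 1 / z) = \<epsilon> * z powr (5 / 2) * A.form z"
    and B_modular: "\<And>z. 0 < Im z \<Longrightarrow> B.form (- 1 / z) = \<epsilon> * z powr (5 / 2) * B.form z"
begin

lemma shadow_symmetric:
  assumes "0 < Im z"
  shows "cnj (A.shadow (- cnj z)) = A.shadow z" "cnj (B.shadow (- cnj z)) = B.shadow z"
  by (rule A.shadow_symmetric[OF A_modular assms], assumption)
    (rule B.shadow_symmetric[OF B_modular assms], assumption)

definition pairing :: "complex \<Rightarrow> complex" where
  "pairing z = A.form z * B.shadow z"

text \<open>The weights 5/2 and \<open>- 1 / 2\<close> add up to 2 and the multipliers are conjugate
  of modulus 1, so \<open>pairing z dz\<close> is invariant under inversion.\<close>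

lemma pairing_minus_one_over:
  assumes z: "0 < Im z"
  shows "pairing (- 1 / z) = z\<^sup>2 * pairing z"
proof -
  have z0: "0 < norm z" using z by auto
  have e: "\<epsilon> * cnj \<epsilon> = 1"
    using A.norm_multiplier[OF A_modular] complex_norm_square[of \<epsilon>] by simp
  have "z powr (5 / 2) * cnj (z powr (5 / 2)) = of_real ((norm z powr (5 / 2))\<^sup>2)"
    unfolding norm_powr_five_halves[symmetric] by (rule complex_norm_square[symmetric])
  also have "(norm z powr (5 / 2))\<^sup>2 = norm z ^ 5"
    using z0 by (simp add: powr_powr powr_realpow[symmetric] flip: powr_numeral)
  finally have "z powr (5 / 2) * shadow_automorphy z = z\<^sup>2"
    using z0 by (simp add: shadow_automorphy_def field_simps)
  moreover have "B.shadow (- 1 / z) = cnj \<epsilon> * shadow_automorphy z * B.shadow z"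
    by (rule B.shadow_modular[OF B_modular z])
  then have "pairing (- 1 / z) = (\<epsilon> * cnj \<epsilon>) * (z powr (5 / 2) * shadow_automorphy z) * pairing z"
    unfolding pairing_def A_modular[OF z] by (simp only: mult_ac)
  ultimately show ?thesis using e by simp
qed

lemma pairing_plus_one:
  assumes z: "0 < Im z"
  shows "pairing (z + 1) = pairing z"
  unfolding pairing_def A.form_periodic[OF m_eq z] B.shadow_periodic[OF m'_eq z]
  by (simp add: cis_mult)

lemma form_continuous_line:
  assumes "0 < y"
  shows "continuous_on {0..1} (\<lambda>x. A.form (Complex x y))"
  by (rule continuous_on_compose2[OF A.form_continuous Complex_curve_continuous]) (use assms in auto)

text \<open>The integral is the constant term of the product. The principal part of the shadow
  selects index \<open>M'\<close> of the form, and its singular term when \<open>m = m'\<close>;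
  each power \<open>24 * k + 23\<close> in the shadow meets only the nonholomorphic term with the
  same number, where the exponentials cancel and the incomplete Gamma value is left.\<close>

lemma pairing_has_integral:
  assumes y: "0 < y"
  shows "((\<lambda>x. pairing (Complex x y)) has_integral
    of_real (of_int m' powr (- 3 / 2)) * (cp M' + (if m = m' then \<i> * beta_fun (- of_int m * y) else 0))
    - (\<Sum>k. B.shadow_coeff k * cm k * of_real (upper_Gamma (- 3 / 2) (pi * (24 * real k + 23) * y / 6)))) {0..1}"
proof -
  define E where "E = (\<lambda>r. complex_of_real (exp (- (pi * y / 12) * r)))"
  have EE: "E r * of_real (exp (pi * y / 12 * r)) = 1" "E (- r) * E r = 1" for r
    by (simp_all add: E_def flip: of_real_mult exp_add)
  let ?c = "of_real (of_int m' powr (- 3 / 2)) * E (- of_int m')"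
  have t: "1 / 24 + - real_of_int m' / 24 = of_int (- int M')" by (simp add: m'_eq field_simps)
  have mm: "int M + - int M' = 0 \<longleftrightarrow> m = m'" by (simp add: m_eq m'_eq)
  have "((\<lambda>x. A.form (Complex x y) * cis (2 * pi * (- of_int m' / 24) * x)) has_integral
      cp M' * E (of_int m') + (if m = m' then \<i> * beta_fun (- of_int m * y) * E (of_int m') else 0)) {0..1}"
    using A.form_fourier[OF m_eq y t] unfolding mm by (simp add: E_def m'_eq add.commute cong: if_cong)
  then have "((\<lambda>x. ?c * (A.form (Complex x y) * cis (2 * pi * (- of_int m' / 24) * x))) has_integral
      ?c * (cp M' * E (of_int m') + (if m = m' then \<i> * beta_fun (- of_int m * y) * E (of_int m') else 0))) {0..1}"
    by (rule has_integral_mult_right)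
  moreover have "?c * (cp M' * E (of_int m') + (if m = m' then \<i> * beta_fun (- of_int m * y) * E (of_int m') else 0))
      = of_real (of_int m' powr (- 3 / 2)) * (E (- of_int m') * E (of_int m'))
        * (cp M' + (if m = m' then \<i> * beta_fun (- of_int m * y) else 0))"
    by (simp add: algebra_simps)
  ultimately have 1: "((\<lambda>x. ?c * (A.form (Complex x y) * cis (2 * pi * (- of_int m' / 24) * x))) has_integral
      of_real (of_int m' powr (- 3 / 2)) * (cp M' + (if m = m' then \<i> * beta_fun (- of_int m * y) else 0))) {0..1}"
    unfolding EE(2) by (simp only: mult_1_right)
  define a where "a = (\<lambda>k. B.shadow_coeff k * E (24 * real k + 23))"
  have a: "summable (\<lambda>k. norm (a k))"
    using q_series_summable_norm[OF B.shadow_coeff _ y, of 23] by (simp add: a_def E_def norm_mult)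
  let ?u = "\<lambda>(k::nat) x. cis (2 * pi * ((24 * real k + 23) / 24) * x)"
  have int: "integral {0..1} (\<lambda>x. ?u k x * A.form (Complex x y))
      = cm k * of_real (upper_Gamma (- 3 / 2) (pi * (24 * real k + 23) * y / 6) * exp (pi * y / 12 * (24 * real k + 23)))" for k
  proof (rule integral_unique)
    have t: "1 / 24 + (24 * real k + 23) / 24 = of_int (int k + 1)" by (simp add: field_simps)
    have "\<not> int k + 1 \<le> 0" "\<not> int M + (int k + 1) = 0" "1 \<le> int k + 1" "nat (int k + 1 - 1) = k" by auto
    with A.form_fourier[OF m_eq y t]
    show "((\<lambda>x. ?u k x * A.form (Complex x y)) has_integral
      cm k * of_real (upper_Gamma (- 3 / 2) (pi * (24 * real k + 23) * y / 6) * exp (pi * y / 12 * (24 * real k + 23)))) {0..1}"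
      by (simp only: if_False if_True add_0_left mult.commute[of "A.form _"])
  qed
  have "((\<lambda>x. (\<Sum>k. a k * ?u k x) * A.form (Complex x y)) has_integral
      (\<Sum>k. a k * integral {0..1} (\<lambda>x. ?u k x * A.form (Complex x y)))) {0..1}"
    by (rule integral_suminf_mult[OF a _ _ form_continuous_line[OF y]]) (auto intro!: continuous_intros)
  moreover have "a k * integral {0..1} (\<lambda>x. ?u k x * A.form (Complex x y))
      = B.shadow_coeff k * cm k * of_real (upper_Gamma (- 3 / 2) (pi * (24 * real k + 23) * y / 6))" for k
  proof -
    have "a k * integral {0..1} (\<lambda>x. ?u k x * A.form (Complex x y))
        = B.shadow_coeff k * cm k * of_real (upper_Gamma (- 3 / 2) (pi * (24 * real k + 23) * y / 6))
          * (E (24 * real k + 23) * of_real (exp (pi * y / 12 * (24 * real k + 23))))"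
      unfolding int a_def of_real_mult by (simp only: mult_ac)
    then show ?thesis unfolding EE(1) by simp
  qed
  ultimately have 2: "((\<lambda>x. (\<Sum>k. a k * ?u k x) * A.form (Complex x y)) has_integral
      (\<Sum>k. B.shadow_coeff k * cm k * of_real (upper_Gamma (- 3 / 2) (pi * (24 * real k + 23) * y / 6)))) {0..1}"
    by (simp only:)
  have "?c * (A.form (Complex x y) * cis (2 * pi * (- of_int m' / 24) * x))
      - (\<Sum>k. a k * ?u k x) * A.form (Complex x y) = pairing (Complex x y)" for x
  proof -
    have "q_series 23 B.shadow_coeff (Complex x y) = (\<Sum>k. a k * ?u k x)"
      unfolding q_series_def q_pow_Complex a_def E_def by (simp only: mult.assoc)
    moreover have "q_pow (- of_int m' / 24) (Complex x y) = E (- of_int m') * cis (2 * pi * (- of_int m' / 24) * x)"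
      unfolding q_pow_Complex E_def ..
    ultimately show ?thesis unfolding pairing_def B.shadow_def by (simp only: right_diff_distrib mult_ac)
  qed
  then show ?thesis using has_integral_diff[OF 1 2] by (simp only:)
qed

end

lemma h_series_pair_swap:
  "h_series_pair m cp cm m' cp' cm' M M' \<epsilon> \<Longrightarrow> h_series_pair m' cp' cm' m cp cm M' M \<epsilon>"
  unfolding h_series_pair_def h_series_pair_axioms_def by blast

context h_series_pair
begin

interpretation swapped: h_series_pair m' cp' cm' m cp cm M' M \<epsilon>
  by (rule h_series_pair_swap) (rule h_series_pair_axioms)

text \<open>The \<open>cnj z\<close>-derivative of the pairing is \<open>shadow_factor (Im z) * cnj (A.shadow z) * B.shadow z\<close>. By the
  reflection symmetry of the shadows, the \<open>z\<close>-derivative of the reflected pairing with the two series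
  exchanged is the same up to sign.\<close>

lemma pairing_primitive:
  "\<exists>W. \<forall>z. 0 < Im z \<longrightarrow>
    (W has_derivative (\<lambda>v. pairing z * v + (- swapped.pairing (- cnj z)) * cnj v)) (at z)"
proof -
  let ?H = "{z. 0 < Im z}"
  obtain p where p: "continuous_on ?H p" "\<And>z. 0 < Im z \<Longrightarrow>
    (A.form has_derivative (\<lambda>v. p z * v + shadow_factor (Im z) * cnj (A.shadow z) * cnj v)) (at z)"
    using A.form_derivative by blast
  obtain p' where p': "continuous_on ?H p'" "\<And>z. 0 < Im z \<Longrightarrow>
    (B.form has_derivative (\<lambda>v. p' z * v + shadow_factor (Im z) * cnj (B.shadow z) * cnj v)) (at z)"
    using B.form_derivative by blast
  define P1 where "P1 = (\<lambda>z. p z * B.shadow z + A.form z * deriv B.shadow z)"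
  define Q1 where "Q1 = (\<lambda>z. p' z * A.shadow z + B.form z * deriv A.shadow z)"
  define R where "R = (\<lambda>z. shadow_factor (Im z) * cnj (A.shadow z) * B.shadow z)"
  have cs: "continuous_on ?H A.shadow" "continuous_on ?H B.shadow"
    "continuous_on ?H (deriv A.shadow)" "continuous_on ?H (deriv B.shadow)"
    by (intro holomorphic_on_imp_continuous_on holomorphic_deriv open_halfspace_Im_gt
        A.shadow_holomorphic B.shadow_holomorphic)+
  have cR: "continuous_on ?H R" unfolding R_def by (intro continuous_intros continuous_on_shadow_factor cs)
  have cP: "continuous_on ?H P1" unfolding P1_def by (intro continuous_intros p cs A.form_continuous)
  have "continuous_on ?H Q1" unfolding Q1_def by (intro continuous_intros p' cs B.form_continuous)
  then have cQ: "continuous_on ?H (\<lambda>z. Q1 (- cnj z))"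
    by (rule continuous_on_compose2) (auto intro!: continuous_intros)
  have dP: "(pairing has_derivative (\<lambda>v. P1 z * v + R z * cnj v)) (at z)" if "0 < Im z" for z
    unfolding pairing_def[abs_def] P1_def R_def
    by (rule A.form_mult_derivative[OF p(2) B.shadow_holomorphic that])
  have dQ: "((\<lambda>z. - swapped.pairing (- cnj z)) has_derivative (\<lambda>v. R z * v + Q1 (- cnj z) * cnj v)) (at z)"
    if z: "0 < Im z" for z
  proof -
    let ?w = "- cnj z"
    have w: "0 < Im ?w" using z by simp
    have "(swapped.pairing has_derivative
        (\<lambda>v. Q1 ?w * v + shadow_factor (Im ?w) * cnj (B.shadow ?w) * A.shadow ?w * cnj v)) (at ?w)"
      unfolding swapped.pairing_def[abs_def] Q1_def
      by (rule B.form_mult_derivative[OF p'(2) A.shadow_holomorphic w])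
    moreover have "shadow_factor (Im ?w) * cnj (B.shadow ?w) * A.shadow ?w = R z"
    proof -
      have a: "A.shadow ?w = cnj (A.shadow z)"
        using shadow_symmetric(1)[OF z] by (metis complex_cnj_cnj)
      have b: "cnj (B.shadow ?w) = B.shadow z"
        by (rule shadow_symmetric(2)[OF z])
      have "Im ?w = Im z" by simp
      then show ?thesis unfolding R_def a b by (simp only: mult_ac)
    qed
    ultimately have d: "(swapped.pairing has_derivative (\<lambda>v. Q1 ?w * v + R z * cnj v)) (at ?w)" by (simp only:)
    have "((\<lambda>z. - cnj z) has_derivative (\<lambda>v. - cnj v)) (at z)"
      by (intro derivative_intros)
    from has_derivative_minus[OF has_derivative_compose[OF this d]]
    show ?thesis by (rule has_derivative_eq_rhs) (simp add: fun_eq_iff)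
  qed
  have "\<exists>W. \<forall>z\<in>?H. (W has_derivative (\<lambda>v. pairing z * v + (- swapped.pairing (- cnj z)) * cnj v)) (at z)"
  proof (rule closed_form_primitive[OF open_halfspace_Im_gt convex_halfspace_Im_gt _ _ _ cP cR cQ])
    have "\<i> \<in> ?H" by simp
    then show "?H \<noteq> {}" by blast
  next
    fix z assume "z \<in> ?H"
    then have z: "0 < Im z" by simp
    show "(pairing has_derivative (\<lambda>v. P1 z * v + R z * cnj v)) (at z)" by (rule dP[OF z])
    show "((\<lambda>z. - swapped.pairing (- cnj z)) has_derivative (\<lambda>v. R z * v + Q1 (- cnj z) * cnj v)) (at z)"
      by (rule dQ[OF z])
  qed
  then show ?thesis by simp
qed

text \<open>The integral of the closed one-form over a unit segment is a difference of values of its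
  primitive \<open>W\<close>, hence 0 by periodicity of \<open>W\<close>; reflecting the segment
  identifies the second part of the integral with \<open>J\<close>.\<close>

lemma integral_pairing_swap:
  assumes y: "0 < y" and I: "((\<lambda>x. pairing (Complex x y)) has_integral I) {0..1}"
    and J: "((\<lambda>x. swapped.pairing (Complex x y)) has_integral J) {0..1}"
  shows "I = J"
proof -
  let ?H = "{z. 0 < Im z}"
  let ?Q = "\<lambda>z. - swapped.pairing (- cnj z)"
  obtain W where "\<forall>z. 0 < Im z \<longrightarrow> (W has_derivative (\<lambda>v. pairing z * v + ?Q z * cnj v)) (at z)"
    using pairing_primitive by (rule exE)
  note W = this[rule_format]
  have Q1: "?Q (z + 1) = ?Q z" if z: "0 < Im z" for z
  proof -
    have "0 < Im (- cnj (z + 1))" "- cnj (z + 1) + 1 = - cnj z" using z by simp_all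
    with swapped.pairing_plus_one[of "- cnj (z + 1)"] show ?thesis by (simp only:)
  qed
  have QS: "?Q (- 1 / z) = (cnj z)\<^sup>2 * ?Q z" if z: "0 < Im z" for z
  proof -
    have w: "0 < Im (- cnj z)" using z by simp
    have "- cnj (- 1 / z) = - 1 / (- cnj z)" by simp
    then show ?thesis
      by (simp only: swapped.pairing_minus_one_over[OF w] power2_minus mult_minus_right)
  qed
  \<comment> \<open>\<open>P\<close> and \<open>Q\<close> say that pulling back along
    \<open>\<phi>\<close>, whose derivative is \<open>d\<close>, preserves the one-form; then
    \<open>W (\<phi> z) - W z\<close> has derivative 0 and can be evaluated at the fixed point
    \<open>w\<close>.\<close>
  have inv: "W (\<phi> z) = W z"
    if hol: "\<And>z. 0 < Im z \<Longrightarrow> (\<phi> has_field_derivative d z) (at z)"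
      and pos: "\<And>z. 0 < Im z \<Longrightarrow> 0 < Im (\<phi> z)"
      and P: "\<And>z. 0 < Im z \<Longrightarrow> pairing (\<phi> z) * d z = pairing z"
      and Q: "\<And>z. 0 < Im z \<Longrightarrow> ?Q (\<phi> z) * cnj (d z) = ?Q z"
      and fix0: "0 < Im w" "\<phi> w = w" and z: "0 < Im z" for \<phi> d w z
  proof -
    have "((\<lambda>z. W (\<phi> z) - W z) has_derivative (\<lambda>v. 0)) (at z within ?H)" if "z \<in> ?H" for z
    proof -
      have z: "0 < Im z" using that by simp
      have "(\<phi> has_derivative (\<lambda>v. d z * v)) (at z)"
        using hol[OF z] by (simp only: has_field_derivative_def)
      then have "((\<lambda>z. W (\<phi> z)) has_derivative (\<lambda>v. pairing (\<phi> z) * (d z * v) + ?Q (\<phi> z) * cnj (d z * v))) (at z)"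
        by (rule has_derivative_compose[where f = \<phi> and g = W and f' = "\<lambda>v. d z * v"
            and g' = "\<lambda>v. pairing (\<phi> z) * v + ?Q (\<phi> z) * cnj v", OF _ W[OF pos[OF z]]])
      also have "(\<lambda>v. pairing (\<phi> z) * (d z * v) + ?Q (\<phi> z) * cnj (d z * v))
          = (\<lambda>v. pairing z * v + ?Q z * cnj v)"
      proof (rule ext)
        fix v
        have "pairing (\<phi> z) * (d z * v) + ?Q (\<phi> z) * cnj (d z * v)
            = (pairing (\<phi> z) * d z) * v + (?Q (\<phi> z) * cnj (d z)) * cnj v"
          unfolding complex_cnj_mult by (rule arg_cong2[where f = "(+)"]) (rule mult.assoc[symmetric])+
        then show "pairing (\<phi> z) * (d z * v) + ?Q (\<phi> z) * cnj (d z * v) = pairing z * v + ?Q z * cnj v"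
          unfolding P[OF z] Q[OF z] .
      qed
      finally have "((\<lambda>z. W (\<phi> z) - W z) has_derivative
          (\<lambda>v. (pairing z * v + ?Q z * cnj v) - (pairing z * v + ?Q z * cnj v))) (at z)"
        using W[OF z] by (rule has_derivative_diff)
      then show ?thesis unfolding diff_self by (rule has_derivative_at_withinI)
    qed
    with convex_halfspace_Im_gt have "\<exists>c. \<forall>z\<in>?H. W (\<phi> z) - W z = c"
      by (rule has_derivative_zero_constant)
    then obtain c where "\<forall>z\<in>?H. W (\<phi> z) - W z = c" by (rule exE)
    then have c: "W (\<phi> z) - W z = c" if "0 < Im z" for z using that by simp
    have "c = 0" using c[OF fix0(1)] unfolding fix0(2) by simp
    then show ?thesis using c[OF z] by simp
  qed
  have nz: "z \<noteq> 0" if "0 < Im z" for z using that by auto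
  have nz1: "z + 1 \<noteq> 0" if "0 < Im z" for z
    using nz[of "z + 1"] that by auto
  have S: "W (- 1 / z) = W z" if z: "0 < Im z" for z
  proof (rule inv[where d = "\<lambda>z. 1 / z\<^sup>2" and w = \<i>])
    fix z :: complex assume z: "0 < Im z"
    show "((\<lambda>z. - 1 / z) has_field_derivative 1 / z\<^sup>2) (at z)"
      using nz[OF z] by (auto intro!: derivative_eq_intros simp: power2_eq_square)
    show "0 < Im (- 1 / z)" unfolding Im_minus_one_over using z nz[OF z] by simp
    show "pairing (- 1 / z) * (1 / z\<^sup>2) = pairing z"
      unfolding pairing_minus_one_over[OF z] using nz[OF z] by simp
    show "?Q (- 1 / z) * cnj (1 / z\<^sup>2) = ?Q z"
      unfolding QS[OF z] using nz[OF z] by simp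
  qed (use z in auto)
  \<comment> \<open>The primitive third root of unity in the half plane:
    \<open>\<rho>\<^sup>2 + \<rho> + 1 = 0\<close> is the fixed point equation of
    \<open>z \<mapsto> - 1 / (z + 1)\<close>.\<close>
  define \<rho> where "\<rho> = Complex (- 1 / 2) (sqrt 3 / 2)"
  have \<rho>: "\<rho> * (\<rho> + 1) = - 1" by (simp add: \<rho>_def complex_eq_iff)
  have ST: "W (- 1 / (z + 1)) = W z" if z: "0 < Im z" for z
  proof (rule inv[where d = "\<lambda>z. 1 / (z + 1)\<^sup>2" and w = \<rho>])
    fix z :: complex assume z: "0 < Im z"
    have z1: "0 < Im (z + 1)" using z by simp
    show "((\<lambda>z. - 1 / (z + 1)) has_field_derivative 1 / (z + 1)\<^sup>2) (at z)"
      using nz1[OF z] by (auto intro!: derivative_eq_intros simp: power2_eq_square)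
    show "0 < Im (- 1 / (z + 1))" unfolding Im_minus_one_over using z nz1[OF z] by simp
    show "pairing (- 1 / (z + 1)) * (1 / (z + 1)\<^sup>2) = pairing z"
      unfolding pairing_minus_one_over[OF z1] pairing_plus_one[OF z] using nz1[OF z] by simp
    have "cnj (z + 1) \<noteq> 0" using nz1[OF z] complex_cnj_zero_iff[of "z + 1"] by blast
    then show "?Q (- 1 / (z + 1)) * cnj (1 / (z + 1)\<^sup>2) = ?Q z"
      unfolding QS[OF z1] Q1[OF z] by (simp add: del: complex_cnj_add)
  next
    show "0 < Im \<rho>" by (simp add: \<rho>_def)
    then show "- 1 / (\<rho> + 1) = \<rho>" using \<rho> nz1[of \<rho>] by (simp add: field_simps)
  qed (use z in auto)
  \<comment> \<open>Both \<open>W (z + 1)\<close> and \<open>W z\<close> equal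
    \<open>W (- 1 / (z + 1))\<close>.\<close>
  have T: "W (z + 1) = W z" if z: "0 < Im z" for z
    using S[of "z + 1"] ST[of z] z by simp
  have "((\<lambda>x. pairing (Complex x y) + ?Q (Complex x y)) has_integral W (Complex 1 y) - W (Complex 0 y)) {0..1}"
  proof (rule fundamental_theorem_of_calculus)
    fix x :: real
    have "((\<lambda>x. Complex x y) has_derivative (\<lambda>h. of_real h)) (at x within {0..1})"
      unfolding Complex_eq by (auto intro!: derivative_eq_intros)
    from has_derivative_compose[OF this W[of "Complex x y"]] y
    show "((\<lambda>x. W (Complex x y)) has_vector_derivative pairing (Complex x y) + ?Q (Complex x y)) (at x within {0..1})"
      by (simp add: has_vector_derivative_def scaleR_conv_of_real algebra_simps)
  qed simp
  moreover have "Complex 1 y = Complex 0 y + 1" by (simp add: complex_eq_iff)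
  ultimately have WI: "((\<lambda>x. pairing (Complex x y) + ?Q (Complex x y)) has_integral 0) {0..1}"
    using T[of "Complex 0 y"] y by simp
  \<comment> \<open>The substitution \<open>x \<mapsto> 1 - x\<close> realises the reflection: it
    maps the segment to itself, and the shift by 1 is absorbed by periodicity.\<close>
  have "((\<lambda>x. swapped.pairing (Complex ((- 1) *\<^sub>R x + 1) y)) has_integral (1 / (\<bar>- 1\<bar> ^ DIM(real))) *\<^sub>R J)
      ((\<lambda>x. (1 / (- 1)) *\<^sub>R x + - ((1 / (- 1)) *\<^sub>R 1)) ` cbox 0 1)"
    by (rule has_integral_affinity) (use J in auto)
  moreover have "(\<lambda>x::real. (1 / (- 1)) *\<^sub>R x + - ((1 / (- 1)) *\<^sub>R 1)) ` cbox 0 1 = {0..1}"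
    using image_diff_atLeastAtMost[of "1 :: real" 0 1] by simp
  moreover have "swapped.pairing (Complex ((- 1) *\<^sub>R x + 1) y) = swapped.pairing (- cnj (Complex x y))" for x
  proof -
    have "Complex ((- 1) *\<^sub>R x + 1) y = - cnj (Complex x y) + 1" by (simp add: complex_eq_iff)
    then show ?thesis using swapped.pairing_plus_one[of "- cnj (Complex x y)"] y by simp
  qed
  ultimately have "((\<lambda>x. swapped.pairing (- cnj (Complex x y))) has_integral J) {0..1}" by simp
  from has_integral_diff[OF I this]
  have "((\<lambda>x. pairing (Complex x y) + ?Q (Complex x y)) has_integral I - J) {0..1}"
    by (simp only: diff_conv_add_uminus)
  from has_integral_unique[OF this WI] show "I = J" by simp
qed

text \<open>Both integrals contain the same series of incomplete Gamma values. Once it cancels, the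
  contributions of the two principal parts are equal; for \<open>m = m'\<close> they carry the same
  singular term as well.\<close>

lemma coefficient_duality:
  "of_real (of_int m powr (3 / 2)) * cp M' = of_real (of_int m' powr (3 / 2)) * cp' M"
proof -
  have real: "cnj (d k) = d k" if "subexponential d"
    "\<And>z. 0 < Im z \<Longrightarrow> q_series 23 (\<lambda>j. cnj (d j)) z = q_series 23 d z" for d k
    by (rule q_series_coefficients_unique[OF subexponential_cnj[OF that(1)] that(1) _ that(2)]) auto
  have rA: "cnj (A.shadow_coeff k) = A.shadow_coeff k" for k
  proof (rule real[OF A.shadow_coeff])
    show "q_series 23 (\<lambda>j. cnj (A.shadow_coeff j)) z = q_series 23 A.shadow_coeff z" if z: "0 < Im z" for z
      using shadow_symmetric(1)[OF z] A.shadow_minus_cnj[OF z] by (simp add: A.shadow_def)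
  qed
  have rB: "cnj (B.shadow_coeff k) = B.shadow_coeff k" for k
  proof (rule real[OF B.shadow_coeff])
    show "q_series 23 (\<lambda>j. cnj (B.shadow_coeff j)) z = q_series 23 B.shadow_coeff z" if z: "0 < Im z" for z
      using shadow_symmetric(2)[OF z] B.shadow_minus_cnj[OF z] by (simp add: B.shadow_def)
  qed
  \<comment> \<open>Reality of the shadow coefficients makes the minus-coefficients real, so either
    side is \<open>cm k * cm' k\<close> times the same power of \<open>24 * k + 23\<close>.\<close>
  have coeff: "B.shadow_coeff k * cm k = A.shadow_coeff k * cm' k" for k
    using rA[of k] rB[of k] by (simp add: A.shadow_coeff_def B.shadow_coeff_def mult_ac)
  have cancel: "a - c = b - c \<Longrightarrow> a = b" for a b c :: complex by simp
  from integral_pairing_swap[OF zero_less_one pairing_has_integral[OF zero_less_one]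
      swapped.pairing_has_integral[OF zero_less_one], unfolded coeff]
  have eq: "of_real (of_int m' powr (- 3 / 2)) * (cp M' + (if m = m' then \<i> * beta_fun (- of_int m * 1) else 0))
    = of_real (of_int m powr (- 3 / 2)) * (cp' M + (if m' = m then \<i> * beta_fun (- of_int m' * 1) else 0))"
    by (rule cancel)
  have pos: "0 < real_of_int m" "0 < real_of_int m'" using A.m_pos B.m_pos by auto
  show ?thesis
  proof (cases "m = m'")
    case True
    then show ?thesis using eq pos by simp
  next
    case False
    with eq have "of_real (of_int m' powr (- 3 / 2)) * cp M' = of_real (of_int m powr (- 3 / 2)) * cp' M" by simp
    moreover have "a powr (- 3 / 2) = inverse (a powr (3 / 2))" for a :: real
      using powr_minus[of a "3 / 2"] by simp
    ultimately show ?thesis using pos by (simp add: field_simps)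
  qed
qed

end

section \<open>From the defining expansion to subexponential coefficients\<close>

lemma subexponentialI_q_series:
  assumes "\<And>y. 0 < y \<Longrightarrow> summable (\<lambda>j. norm (c j * q_pow ((24 * real j + s) / 24) (\<i> * of_real y)))"
  shows "subexponential c"
  unfolding subexponential_def
proof (intro allI impI)
  fix \<delta> :: real assume \<delta>: "0 < \<delta>"
  define y where "y = \<delta> / (2 * pi)"
  have y: "0 < y" using \<delta> by (simp add: y_def)
  have "summable (\<lambda>j. exp (\<delta> * s / 24) * (norm (c j) * exp (- (pi * y / 12) * (24 * real j + s))))"
    using assms[OF y] unfolding norm_q_series_term by (intro summable_mult) simp
  moreover have "exp (\<delta> * s / 24) * (norm (c j) * exp (- (pi * y / 12) * (24 * real j + s)))
      = norm (c j) * exp (- \<delta> * real j)" for j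
  proof -
    have "\<delta> * s / 24 + - (pi * y / 12) * (24 * real j + s) = - \<delta> * real j"
      by (simp add: y_def field_simps)
    then have "exp (\<delta> * s / 24) * exp (- (pi * y / 12) * (24 * real j + s)) = exp (- \<delta> * real j)"
      by (simp only: exp_add[symmetric])
    then show ?thesis by (metis mult.left_commute)
  qed
  ultimately show "summable (\<lambda>j. norm (c j) * exp (- \<delta> * real j))" by (simp only:)
qed

lemma beta_fun_q_pow:
  assumes "0 < r" "0 < Im z"
  shows "beta_fun (r * Im z) * q_pow (- r / 24) z = nonhol_term r z"
proof -
  have "beta_fun (r * Im z) = of_real (upper_Gamma (- 3 / 2) (pi * (r * Im z) / 6))"
    unfolding beta_fun_def using assms by (intro inc_Gamma_pos) auto
  then show ?thesis by (simp add: nonhol_term_def mult.assoc)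
qed

text \<open>The growth of the coefficients is extracted from convergence of the expansion on the
  imaginary axis, at arbitrarily small height.\<close>

lemma is_h_form_imp_h_series:
  assumes m: "0 < m" and h: "is_h_form m h pp pm"
  defines "cp \<equiv> \<lambda>j. pp (24 * int j + 1)" and "cm \<equiv> \<lambda>j. pm (24 * int j + 23)"
  shows "h_series m cp cm" and "0 < Im z \<Longrightarrow> h z = h_series.form m cp cm z"
proof -
  let ?P = "\<lambda>z n. pp n * q_pow (of_int n / 24) z"
  let ?N = "\<lambda>z n. pm n * beta_fun (of_int n * Im z) * q_pow (- of_int n / 24) z"
  have sP: "?P z summable_on {n. 0 < n \<and> [n = 1] (mod 24)}"
    and sN: "?N z summable_on {n. 0 < n \<and> [n = - 1] (mod 24)}"
    and hz: "h z = (\<Sum>\<^sub>\<infinity>n\<in>{n. 0 < n \<and> [n = 1] (mod 24)}. ?P z n)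
            + \<i> * beta_fun (- of_int m * Im z) * q_pow (of_int m / 24) z
            + (\<Sum>\<^sub>\<infinity>n\<in>{n. 0 < n \<and> [n = - 1] (mod 24)}. ?N z n)"
    if "0 < Im z" for z
    using h that by (auto simp: is_h_form_def upper_half_plane_def)
  have c23: "[- 1 = 23] (mod (24 :: int))" by (simp add: cong_def)
  have P: "?P z (24 * int j + 1) = cp j * q_pow ((24 * real j + 1) / 24) z" for z j
    by (simp add: cp_def)
  have N: "?N z (24 * int j + 23) = cm j * nonhol_term (24 * real j + 23) z" if "0 < Im z" for z j
    using beta_fun_q_pow[of "24 * real j + 23" z] that by (simp add: cm_def)
  have scp: "subexponential cp"
  proof (rule subexponentialI_q_series[where s = 1])
    fix y :: real assume y: "0 < y"
    then show "summable (\<lambda>j. norm (cp j * q_pow ((24 * real j + 1) / 24) (\<i> * of_real y)))"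
      using residue_class_expansion(1)[OF sP[of "\<i> * of_real y"], of 1] unfolding P by simp
  qed
  have scm: "subexponential cm"
  proof (rule subexponentialI_upper_Gamma[where s = 23])
    fix y :: real assume y: "0 < y"
    have N': "?N (Complex 0 y) (24 * int j + 23) = cm j * nonhol_term (24 * real j + 23) (Complex 0 y)" for j
      by (rule N) (use y in simp)
    have "summable (\<lambda>j. norm (?N (Complex 0 y) (24 * int j + 23)))"
      by (rule residue_class_expansion(1)[OF sN _ _ c23]) (use y in simp_all)
    then have "summable (\<lambda>j. norm (cm j * nonhol_term (24 * real j + 23) (Complex 0 y)))"
      unfolding N' .
    moreover have "norm (cm j * nonhol_term (24 * real j + 23) (Complex 0 y))
      = norm (cm j) * upper_Gamma (- 3 / 2) (pi * (24 * real j + 23) * y / 6) * exp (pi * (24 * real j + 23) * y / 12)" for j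
      unfolding norm_mult by (subst norm_nonhol_term) (use y in auto)
    ultimately show "summable (\<lambda>j. norm (cm j) * upper_Gamma (- 3 / 2) (pi * (24 * real j + 23) * y / 6)
      * exp (pi * (24 * real j + 23) * y / 12))" by (simp only:)
  qed simp
  show H: "h_series m cp cm" by standard (fact m scp scm)+
  show "h z = h_series.form m cp cm z" if z: "0 < Im z"
  proof -
    have "(\<Sum>\<^sub>\<infinity>n\<in>{n. 0 < n \<and> [n = 1] (mod 24)}. ?P z n) = q_series 1 cp z"
      unfolding q_series_def P[symmetric] by (rule residue_class_expansion(2)[OF sP[OF z]]) auto
    moreover have "(\<Sum>\<^sub>\<infinity>n\<in>{n. 0 < n \<and> [n = - 1] (mod 24)}. ?N z n) = h_series.nonhol cm z"
      unfolding h_series.nonhol_def[OF H] N[OF z, symmetric]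
      by (rule residue_class_expansion(2)[OF sN[OF z] _ _ c23]) auto
    ultimately show ?thesis
      unfolding hz[OF z] h_series.form_def[OF H] sing_term_def by simp
  qed
qed

theorem corollary4:
  fixes m n :: int
    and h_m h_n :: "complex \<Rightarrow> complex"
    and p_m_plus p_m_minus p_n_plus p_n_minus :: "int \<Rightarrow> complex"
  assumes "0 < m" and "[m = 1] (mod 24)"
    and "0 < n" and "[n = 1] (mod 24)"
    and "is_h_form m h_m p_m_plus p_m_minus"
    and "is_h_form n h_n p_n_plus p_n_minus"
  shows "of_real (of_int n powr (3 / 2)) * p_n_plus m = of_real (of_int m powr (3 / 2)) * p_m_plus n"
proof -
  \<comment> \<open>The entries belong to \<open>z \<mapsto> - 1 / z\<close>. The multiplier does
    not depend on the form, so both forms share this \<open>\<epsilon>\<close>.\<close>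
  define \<epsilon> where "\<epsilon> = eta_multiplier 0 (- 1) 1 0"
  have modular: "h_series.form k (\<lambda>j. p (24 * int j + 1)) (\<lambda>j. q (24 * int j + 23)) (- 1 / z)
      = \<epsilon> * z powr (5 / 2) * h_series.form k (\<lambda>j. p (24 * int j + 1)) (\<lambda>j. q (24 * int j + 23)) z"
    if k: "0 < k" and h: "is_h_form k h p q" and z: "0 < Im z" for k h p q z
  proof -
    have z0: "z \<noteq> 0" using z by auto
    have w: "0 < Im (- 1 / z)" unfolding Im_minus_one_over using z z0 by simp
    have "h \<in> weak_harmonic_forms (5 / 2)" using h by (simp add: is_h_form_def)
    then have "\<forall>a b c d. a * d - b * c = 1 \<longrightarrow> (\<forall>z\<in>upper_half_plane. h (moebius_int a b c d z) =
        eta_multiplier a b c d * (of_int c * z + of_int d) powr (of_real (5 / 2)) * h z)"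
      by (simp add: weak_harmonic_forms_def)
    from this[rule_format, of 0 0 "- 1" 1 z] z
    have "h (- 1 / z) = \<epsilon> * z powr (5 / 2) * h z"
      by (simp add: moebius_int_def upper_half_plane_def \<epsilon>_def)
    then show ?thesis
      unfolding is_h_form_imp_h_series(2)[OF k h z, symmetric] is_h_form_imp_h_series(2)[OF k h w, symmetric] .
  qed
  obtain M where M: "m = 24 * int M + 1"
  proof -
    obtain k where k: "m - 1 = 24 * k" using \<open>[m = 1] (mod 24)\<close> by (auto simp: cong_iff_dvd_diff elim: dvdE)
    then have "m = 24 * int (nat k) + 1" using \<open>0 < m\<close> by simp
    then show ?thesis by (rule that)
  qed
  obtain N where N: "n = 24 * int N + 1"
  proof -
    obtain k where k: "n - 1 = 24 * k" using \<open>[n = 1] (mod 24)\<close> by (auto simp: cong_iff_dvd_diff elim: dvdE)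
    then have "n = 24 * int (nat k) + 1" using \<open>0 < n\<close> by simp
    then show ?thesis by (rule that)
  qed
  \<comment> \<open>With \<open>h_n\<close> in the first place, \<open>cp M'\<close> of the locale
    is \<open>p_n_plus m\<close> and \<open>cp' M\<close> is \<open>p_m_plus n\<close>.\<close>
  interpret h_series_pair n "\<lambda>j. p_n_plus (24 * int j + 1)" "\<lambda>j. p_n_minus (24 * int j + 23)"
    m "\<lambda>j. p_m_plus (24 * int j + 1)" "\<lambda>j. p_m_minus (24 * int j + 23)" N M \<epsilon>
    by (rule h_series_pair.intro[OF
          is_h_form_imp_h_series(1)[OF assms(3,6)] is_h_form_imp_h_series(1)[OF assms(1,5)]
          h_series_pair_axioms.intro[OF N M modular[OF assms(3,6)] modular[OF assms(1,5)]]])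
  show ?thesis using coefficient_duality by (simp only: M[symmetric] N[symmetric])
qed

end
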